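(* For every integer $k\ge 2$, as $n\to\infty$, $$H_n(C_{2k})\le n^{\left(1-\frac{2}{3k}\right)n+o(n)}.$$
   Context: For a graph $G$, $H_n(G)$ denotes the maximum number of Hamilton paths in the complete graph $K_n$ such that the union of any two of them contains $G$ as a subgraph. $C_m$ denotes the cycle of length $m$. *)

theory Defs
  imports Complex_Main "HOL-Library.Landau_Symbols"
begin

definition path_edges :: "nat list \<Rightarrow> nat set set" where
  "path_edges p = {{p ! i, p ! Suc i} | i. Suc i < length p}"

definition ham_paths :: "nat \<Rightarrow> nat set set set" where
  "ham_paths n = {path_edges p | p. distinct p \<and> set p = {0..<n}}"

definition contains_cycle :: "nat set set \<Rightarrow> nat \<Rightarrow> bool" where
  "contains_cycle E m \<longleftrightarrow>
     (\<exists>vs. length vs = m \<and> distinct vs \<and> (\<forall>i<m. {vs ! i, vs ! ((i + 1) mod m)} \<in> E))"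

definition H_cycle :: "nat \<Rightarrow> nat \<Rightarrow> nat" where
  "H_cycle m n = Max {card F | F. F \<subseteq> ham_paths n \<and>
      (\<forall>P\<in>F. \<forall>Q\<in>F. P \<noteq> Q \<longrightarrow> contains_cycle (P \<union> Q) m)}"

end

theory Submission
  imports Defs "HOL-Algebra.Algebraic_Closure_Type" "HOL-Computational_Algebra.Polynomial"
    "HOL-Computational_Algebra.Primes" "HOL-Library.FuncSet"
begin

text \<open>If I is a family of Hamilton paths all contained in one graph without 2k-cycles, then symmetry
  under permutations of the vertices gives \<open>H_cycle (2 * k) n * card I \<le> n!\<close>, so it suffices to find
  such a family of size about n powr (2 n / (3 k)).

  Over a field with q elements, the matrices with rows (1, x), (0, 1) and (1, 0), (t y, 1) generate a
  group in which an alternating word of 2k nontrivial letters has a trace of degree exactly k in t.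
  A matrix of determinant 1 that is trivial modulo t ^ s has trace 2 modulo t ^ (2 s), so words of
  this length stay nontrivial in the quotient modulo roughly t ^ (k / 2 + 1), which has only
  q ^ (3 k / 2) elements. The coset graph of the two root subgroups in this quotient therefore has no
  nonbacktracking closed walk of length 2k. Splitting the field into disjoint colour classes of size
  d = q / L cuts it into L layers such that consecutive layers span d-regular bipartite graphs.

  Replace each vertex by d copies and each edge by one of the d perfect matchings i + j = c (mod d)
  between the copies of its ends; such a lift has no 2k-cycle either.
  A labelling of the edges by 0, ..., d - 1 at either end, injective around each vertex, selects
  perfect matchings between consecutive layers of such a lift. There are (d!) ^ (2 m) labellings
  between two layers of m vertices but only d ^ (d m) lifts, so by the pigeonhole principle some lift
  contains at least (d / e ^ 2) ^ (d m) perfect matchings for each pair of layers, without any need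
  for a lower bound on permanents. Stacking them gives linear forests with few components, which are
  completed to Hamilton paths through fresh connecting paths too long for a 2k-cycle. Finally L
  tends to infinity.\<close>

subsection \<open>Finite subfields of characteristic two\<close>

definition subring_set :: "'a::ring_1 set \<Rightarrow> bool" where
  "subring_set F \<longleftrightarrow> 0 \<in> F \<and> 1 \<in> F \<and> (\<forall>x\<in>F. \<forall>y\<in>F. x + y \<in> F \<and> x - y \<in> F \<and> x * y \<in> F)"

text \<open>A root \<open>a\<close> splits off a factor, p = (X - a) * r. Then p' = r + (X - a) * r'
  shows that \<open>a\<close> is not a root of r and that r again shares no root with its
  derivative, so every factor contributes a new root.\<close>

lemma card_roots_rsquarefree:
  fixes p :: "'a::alg_closed_field poly"
  assumes "p \<noteq> 0" "\<And>x. poly p x = 0 \<Longrightarrow> poly (pderiv p) x \<noteq> 0"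
  shows "card {x. poly p x = 0} = degree p"
  using assms
proof (induction "degree p" arbitrary: p)
  case 0
  then obtain c where "p = [:c:]" by (metis degree_eq_zeroE)
  with 0 show ?case by auto
next
  case (Suc n)
  then obtain a where a: "poly p a = 0"
    using alg_closed_imp_poly_has_root[of p] by auto
  then obtain r where r: "p = [:-a, 1:] * r"
    by (metis dvdE poly_eq_0_iff_dvd)
  have r0: "r \<noteq> 0" using r Suc.prems by auto
  have deg: "n = degree r"
    using Suc.hyps(2) r0 unfolding r by (subst (asm) degree_mult_eq) auto
  have der: "poly (pderiv p) x = poly r x + (x - a) * poly (pderiv r) x" for x
    unfolding r by (subst pderiv_mult) (simp add: pderiv_pCons algebra_simps)
  have ra: "poly r a \<noteq> 0" using Suc.prems(2)[OF a] der[of a] by simp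
  have "poly (pderiv r) x \<noteq> 0" if "poly r x = 0" for x
    using Suc.prems(2)[of x] der[of x] that r by auto
  hence "card {x. poly r x = 0} = degree r"
    using Suc.hyps(1)[OF deg r0] by auto
  moreover have "{x. poly p x = 0} = insert a {x. poly r x = 0}"
    unfolding r by (auto simp: algebra_simps)
  ultimately show ?case
    using poly_roots_finite[OF r0] ra deg Suc.hyps(2) by simp
qed

text \<open>The set consists of the fixed points of x -> x^q with q = 2^j. X^q - X has derivative
  -1, hence q distinct roots, and the Frobenius identity gives closure under sums. Working inside
  one algebraic closure puts the fields of all sizes 2^j into a single type.\<close>

lemma subfield_gf2_alg_closure:
  assumes "j > 0"
  shows "\<exists>F :: gf2 alg_closure set. subring_set F \<and> finite F \<and> card F = 2 ^ j"
proof -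
  define q where "q = (2::nat) ^ j"
  have q2: "q \<ge> 2" unfolding q_def using assms by (cases j) auto
  define p :: "gf2 alg_closure poly" where "p = monom 1 q - [:0, 1:]"
  have char2: "CHAR(gf2 alg_closure) = 2"
  proof -
    have "(1 :: gf2) + 1 = 0" by transfer simp
    hence "of_nat 2 = (0 :: gf2)" by simp
    hence "CHAR(gf2) dvd 2" by (simp only: of_nat_eq_0_iff_char_dvd)
    moreover have "prime CHAR(gf2)" by simp
    ultimately show ?thesis by (simp add: primes_dvd_imp_eq)
  qed
  have two: "(2 :: gf2 alg_closure) = 0"
    using of_nat_CHAR[where 'a = "gf2 alg_closure"] unfolding char2 by simp
  have q0: "(of_nat q :: gf2 alg_closure) = 0"
    unfolding q_def using two assms by simp
  have deg: "degree p = q"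
    unfolding p_def diff_conv_add_uminus using q2
    by (subst degree_add_eq_left) (simp_all add: degree_monom_eq)
  have p0: "p \<noteq> 0" using deg q2 by auto
  have "pderiv p = [:-1:]"
    unfolding p_def using q0 by (simp add: pderiv_diff pderiv_monom pderiv_pCons)
  hence "card {x. poly p x = 0} = degree p"
    by (intro card_roots_rsquarefree p0) auto
  moreover have eq: "{x. poly p x = 0} = {x. x ^ q = x}"
    by (simp add: p_def poly_monom)
  have add: "(x + y) ^ q = x ^ q + y ^ q" for x y :: "gf2 alg_closure"
    using freshmans_dream'[where 'a = "gf2 alg_closure"] char2 unfolding q_def by auto
  have "subring_set {x :: gf2 alg_closure. x ^ q = x}"
  proof -
    \<comment> \<open>In characteristic 2 differences are sums, so closure under \<open>-\<close>
      comes for free.\<close>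
    have minus: "x - y = x + y" for x y :: "gf2 alg_closure"
    proof -
      have "y + y = 0" using two by (simp flip: mult_2)
      thus ?thesis by (simp add: diff_eq_eq add.assoc)
    qed
    show ?thesis
      unfolding subring_set_def minus using q2 by (auto simp: add power_mult_distrib)
  qed
  moreover have "finite {x. poly p x = 0}" using poly_roots_finite[OF p0] .
  ultimately show ?thesis unfolding deg eq q_def by blast
qed

subsection \<open>Alternating words in a congruence quotient of a matrix group\<close>

text \<open>\<open>U\<close> is the set of flags (edges) of a bipartite graph whose vertices are the
  orbits of \<open>al\<close> and of \<open>be\<close>. Each action shifts one of the coordinates
  \<open>xc\<close>, \<open>yc\<close> and keeps the other, so every orbit is a copy of
  \<open>F\<close>. The last axiom excludes nonbacktracking closed walks of k double steps.\<close>

locale flag_system =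
  fixes U :: "'u set" and F :: "'a::ab_group_add set"
    and al be :: "'a \<Rightarrow> 'u \<Rightarrow> 'u" and xc yc :: "'u \<Rightarrow> 'a" and k :: nat
  assumes finite_U: "finite U" and U_nonempty: "U \<noteq> {}"
    and zero_F: "0 \<in> F" and diff_F: "\<And>x y. x \<in> F \<Longrightarrow> y \<in> F \<Longrightarrow> x - y \<in> F"
    and al_in: "\<And>x u. u \<in> U \<Longrightarrow> x \<in> F \<Longrightarrow> al x u \<in> U"
    and be_in: "\<And>x u. u \<in> U \<Longrightarrow> x \<in> F \<Longrightarrow> be x u \<in> U"
    and xc_in: "\<And>u. u \<in> U \<Longrightarrow> xc u \<in> F"
    and yc_in: "\<And>u. u \<in> U \<Longrightarrow> yc u \<in> F"
    and al_0: "\<And>u. u \<in> U \<Longrightarrow> al 0 u = u"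
    and be_0: "\<And>u. u \<in> U \<Longrightarrow> be 0 u = u"
    and al_add: "\<And>x y u. u \<in> U \<Longrightarrow> x \<in> F \<Longrightarrow> y \<in> F \<Longrightarrow> al x (al y u) = al (x + y) u"
    and be_add: "\<And>x y u. u \<in> U \<Longrightarrow> x \<in> F \<Longrightarrow> y \<in> F \<Longrightarrow> be x (be y u) = be (x + y) u"
    and xc_al: "\<And>x u. u \<in> U \<Longrightarrow> x \<in> F \<Longrightarrow> xc (al x u) = xc u + x"
    and yc_al: "\<And>x u. u \<in> U \<Longrightarrow> x \<in> F \<Longrightarrow> yc (al x u) = yc u"
    and xc_be: "\<And>x u. u \<in> U \<Longrightarrow> x \<in> F \<Longrightarrow> xc (be x u) = xc u"
    and yc_be: "\<And>x u. u \<in> U \<Longrightarrow> x \<in> F \<Longrightarrow> yc (be x u) = yc u + x"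
    and no_closed_word: "\<And>\<phi>. (\<And>i. i \<le> k \<Longrightarrow> \<phi> i \<in> U) \<Longrightarrow>
      (\<And>i. i < k \<Longrightarrow> \<exists>x\<in>F-{0}. \<exists>y\<in>F-{0}. \<phi> (Suc i) = al x (be y (\<phi> i))) \<Longrightarrow> \<phi> k \<noteq> \<phi> 0"

section \<open>Matrices over truncated polynomials\<close>

type_synonym 'a quad = "'a poly \<times> 'a poly \<times> 'a poly \<times> 'a poly"

text \<open>A quadruple (a, b, c, d) stands for the matrix with rows (a, b) and (c, d), where a, c, d are
  taken modulo t ^ s and b modulo t ^ r. The two actions are right multiplication by the
  matrices with rows (1, x), (0, 1) and (1, 0), (t y, 1).\<close>

fun mat_upper :: "nat \<Rightarrow> nat \<Rightarrow> 'a::field \<Rightarrow> 'a quad \<Rightarrow> 'a quad" where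
  "mat_upper s r x (a, b, c, d) =
     (a, poly_cutoff r (b + Polynomial.smult x a), c, poly_cutoff s (d + Polynomial.smult x c))"

fun mat_lower :: "nat \<Rightarrow> 'a::field \<Rightarrow> 'a quad \<Rightarrow> 'a quad" where
  "mat_lower s y (a, b, c, d) =
     (poly_cutoff s (a + Polynomial.smult y (pCons 0 b)), b, poly_cutoff s (c + Polynomial.smult y (pCons 0 d)), d)"

definition coeffs_in :: "'a::zero set \<Rightarrow> nat \<Rightarrow> 'a poly \<Rightarrow> bool" where
  "coeffs_in F n p \<longleftrightarrow> (\<forall>i. coeff p i \<in> F) \<and> (\<forall>i\<ge>n. coeff p i = 0)"

text \<open>Matrices of determinant 1 modulo t^s whose reduction modulo t is upper unipotent. Since
  t divides \<open>c\<close>, knowing \<open>b\<close> modulo t^r determines b * c modulo t^s as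
  soon as s \<le> r + 1.\<close>

definition flags :: "'a::field set \<Rightarrow> nat \<Rightarrow> nat \<Rightarrow> 'a quad set" where
  "flags F s r = {(a, b, c, d). coeffs_in F s a \<and> coeffs_in F r b \<and> coeffs_in F s c \<and> coeffs_in F s d \<and>
     coeff a 0 = 1 \<and> coeff c 0 = 0 \<and> coeff d 0 = 1 \<and> Polynomial.monom 1 s dvd a * d - b * c - 1}"

text \<open>Coordinates read off the matrix: because \<open>a\<close> and \<open>d\<close> have
  constant term 1, the upper action adds x to the constant term of \<open>b\<close> and the lower
  one adds y to the linear coefficient of \<open>c\<close>.\<close>

fun flag_X :: "'a::field quad \<Rightarrow> 'a" where "flag_X (a, b, c, d) = coeff b 0"
fun flag_Y :: "'a::field quad \<Rightarrow> 'a" where "flag_Y (a, b, c, d) = coeff c 1"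

lemma monom_dvd_poly_cutoff_diff:
  "n \<le> m \<Longrightarrow> Polynomial.monom 1 n dvd poly_cutoff m p - (p :: 'a::field poly)"
  by (auto simp: monom_1_dvd_iff' coeff_poly_cutoff)

lemma monom_dvd_pCons: "Polynomial.monom 1 n dvd p \<Longrightarrow> Polynomial.monom 1 (Suc n) dvd pCons 0 (p :: 'a::field poly)"
  by (auto simp: monom_1_dvd_iff' coeff_pCons split: nat.splits)

lemma monom_dvd_le: "m \<le> n \<Longrightarrow> Polynomial.monom 1 n dvd p \<Longrightarrow> Polynomial.monom 1 m dvd (p :: 'a::field poly)"
  by (auto simp: monom_1_dvd_iff')

lemma monom_dvd_mult:
  "Polynomial.monom 1 m dvd p \<Longrightarrow> Polynomial.monom 1 n dvd q \<Longrightarrow> Polynomial.monom 1 (m + n) dvd (p * q :: 'a::field poly)"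
  by (metis mult_dvd_mono mult_monom mult_1)

lemma coeffs_in_cutoff_add_smult:
  assumes "subring_set F" "coeffs_in F m p" "coeffs_in F m' q" "x \<in> F"
  shows "coeffs_in F n (poly_cutoff n (p + Polynomial.smult x q))"
proof -
  have "coeff p i + x * coeff q i \<in> F" for i
    using assms unfolding subring_set_def coeffs_in_def by blast
  moreover have "0 \<in> F" using assms(1) unfolding subring_set_def by blast
  ultimately show ?thesis by (simp add: coeffs_in_def coeff_poly_cutoff)
qed

lemma coeffs_in_pCons: "subring_set F \<Longrightarrow> coeffs_in F n p \<Longrightarrow> coeffs_in F (Suc n) (pCons 0 p)"
  by (auto simp: coeffs_in_def coeff_pCons subring_set_def split: nat.splits)

text \<open>Truncating \<open>b\<close> causes an error divisible only by t^r. In the determinant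
  this error is multiplied by \<open>c\<close>, which supplies one more factor t, and
  \<open>s \<le> Suc r\<close> makes that enough.\<close>

lemma mat_upper_in_flags:
  assumes "subring_set F" "1 \<le> r" "r \<le> s" "s \<le> Suc r" "u \<in> flags F s r" "x \<in> F"
  shows "mat_upper s r x u \<in> flags F s r"
proof -
  obtain a b c d where u: "u = (a, b, c, d)" by (cases u)
  have U: "coeffs_in F s a" "coeffs_in F r b" "coeffs_in F s c" "coeffs_in F s d"
    "coeff a 0 = 1" "coeff c 0 = 0" "coeff d 0 = 1" "Polynomial.monom 1 s dvd a * d - b * c - 1"
    using assms(5) unfolding flags_def u by auto
  obtain c' where c': "c = pCons 0 c'" using U(6) by (cases c) auto
  define b' d' where "b' = poly_cutoff r (b + Polynomial.smult x a)" and "d' = poly_cutoff s (d + Polynomial.smult x c)"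
  have in_F: "coeffs_in F r b'" "coeffs_in F s d'"
    unfolding b'_def d'_def using coeffs_in_cutoff_add_smult[OF assms(1)] U assms(6) by blast+
  define e1 e2 where "e1 = b' - (b + Polynomial.smult x a)" and "e2 = d' - (d + Polynomial.smult x c)"
  have "Polynomial.monom 1 r dvd e1" "Polynomial.monom 1 s dvd e2"
    unfolding e1_def e2_def b'_def d'_def by (auto intro: monom_dvd_poly_cutoff_diff)
  hence "Polynomial.monom 1 (Suc r) dvd pCons 0 (e1 * c')" "Polynomial.monom 1 s dvd a * e2"
    by (auto intro: monom_dvd_pCons)
  hence "Polynomial.monom 1 s dvd (a * d - b * c - 1) + a * e2 - e1 * c"
    using U(8) assms(4) unfolding c' by (metis dvd_add dvd_diff monom_dvd_le mult_pCons_right smult_0_left add_0)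
  also have "(a * d - b * c - 1) + a * e2 - e1 * c = a * d' - b' * c - 1"
    unfolding e1_def e2_def by (simp add: algebra_simps)
  finally have "Polynomial.monom 1 s dvd a * d' - b' * c - 1" .
  moreover have "coeff d' 0 = 1" unfolding d'_def using U assms(2,3) by (simp add: coeff_poly_cutoff)
  ultimately have "(a, b', c, d') \<in> flags F s r"
    using U in_F unfolding flags_def by auto
  thus ?thesis unfolding u b'_def d'_def by simp
qed

lemma mat_lower_in_flags:
  assumes "subring_set F" "2 \<le> s" "u \<in> flags F s r" "y \<in> F"
  shows "mat_lower s y u \<in> flags F s r"
proof -
  obtain a b c d where u: "u = (a, b, c, d)" by (cases u)
  have U: "coeffs_in F s a" "coeffs_in F r b" "coeffs_in F s c" "coeffs_in F s d"
    "coeff a 0 = 1" "coeff c 0 = 0" "coeff d 0 = 1" "Polynomial.monom 1 s dvd a * d - b * c - 1"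
    using assms(3) unfolding flags_def u by auto
  define a' c' where "a' = poly_cutoff s (a + Polynomial.smult y (pCons 0 b))"
    and "c' = poly_cutoff s (c + Polynomial.smult y (pCons 0 d))"
  have in_F: "coeffs_in F s a'" "coeffs_in F s c'"
    unfolding a'_def c'_def
    using coeffs_in_cutoff_add_smult[OF assms(1)] coeffs_in_pCons[OF assms(1)] U assms(4) by blast+
  define e1 e2 where "e1 = a' - (a + Polynomial.smult y (pCons 0 b))" and "e2 = c' - (c + Polynomial.smult y (pCons 0 d))"
  have "Polynomial.monom 1 s dvd e1" "Polynomial.monom 1 s dvd e2"
    unfolding e1_def e2_def a'_def c'_def by (auto intro: monom_dvd_poly_cutoff_diff)
  hence "Polynomial.monom 1 s dvd (a * d - b * c - 1) + e1 * d - b * e2"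
    using U(8) by (metis dvd_add dvd_diff dvd_mult dvd_mult2)
  also have "(a * d - b * c - 1) + e1 * d - b * e2 = a' * d - b * c' - 1"
    unfolding e1_def e2_def by (simp add: algebra_simps)
  finally have "Polynomial.monom 1 s dvd a' * d - b * c' - 1" .
  moreover have "coeff a' 0 = 1" "coeff c' 0 = 0"
    unfolding a'_def c'_def using U assms(2) by (simp_all add: coeff_poly_cutoff)
  ultimately have "(a', b, c', d) \<in> flags F s r"
    using U in_F unfolding flags_def by auto
  thus ?thesis unfolding u a'_def c'_def by simp
qed

section \<open>The trace of an alternating word\<close>

lemma dvd_lincomb:
  fixes m :: "'b::comm_ring_1"
  assumes "m dvd p" "m dvd q" "m dvd e"
  shows "m dvd x * p - y * q - e"
  using assms by (simp add: dvd_diff dvd_mult)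

text \<open>If A W = A up to truncation, Cramer's rule gives W = 1 with w1, w3, w4 known modulo t^s
  and w2 modulo t^r. Determinant 1 then reads (w1 - 1) + (w4 - 1) = w2 * w3 - (w1 - 1) * (w4 - 1),
  which is divisible by t^(r + s). So the trace is known to roughly twice the precision of the
  entries.\<close>

lemma mat_word_returns_imp:
  fixes w1 w2 w3 w4 :: "'a::field poly"
  assumes rs: "r \<le> s" "s \<le> Suc r" and k: "0 < k" "k < r + s"
    and det0: "Polynomial.monom 1 s dvd a * d - b * c - 1" and c0: "coeff c 0 = 0"
    and det: "w1 * w4 - w2 * w3 = 1"
    and eqs: "Polynomial.monom 1 s dvd a - (a * w1 + b * w3)" "Polynomial.monom 1 r dvd b - (a * w2 + b * w4)"
      "Polynomial.monom 1 s dvd c - (c * w1 + d * w3)" "Polynomial.monom 1 s dvd d - (c * w2 + d * w4)"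
  shows "coeff (w1 + w4) k = 0"
proof -
  define e1 e4 where "e1 = w1 - 1" and "e4 = w4 - 1"
  have w: "w1 = e1 + 1" "w4 = e4 + 1" unfolding e1_def e4_def by simp_all
  have D: "Polynomial.monom 1 n dvd (a * d - b * c - 1) * p" if "n \<le> s" for p n
    using det0 that monom_dvd_le dvd_mult2 by blast
  obtain c' where c': "c = pCons 0 c'" using c0 by (cases c) auto
  have 1: "Polynomial.monom 1 s dvd e1"
  proof -
    have "Polynomial.monom 1 s dvd b * (c - (c * w1 + d * w3)) - d * (a - (a * w1 + b * w3)) - (a * d - b * c - 1) * e1"
      using eqs D[of s] by (intro dvd_lincomb) auto
    also have "\<dots> = e1" by (simp add: w algebra_simps)
    finally show ?thesis .
  qed
  have 3: "Polynomial.monom 1 s dvd w3"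
  proof -
    have "Polynomial.monom 1 s dvd c * (a - (a * w1 + b * w3)) - a * (c - (c * w1 + d * w3)) - (a * d - b * c - 1) * w3"
      using eqs D[of s] by (intro dvd_lincomb) auto
    also have "\<dots> = w3" by (simp add: w algebra_simps)
    finally show ?thesis .
  qed
  have 4: "Polynomial.monom 1 s dvd e4"
  proof -
    \<comment> \<open>The congruence for \<open>b\<close> holds only modulo t^r; the factor t of
      \<open>c\<close> raises it to t^s.\<close>
    have "Polynomial.monom 1 (Suc r) dvd pCons 0 (c' * (b - (a * w2 + b * w4)))"
      using eqs by (intro monom_dvd_pCons) auto
    hence "Polynomial.monom 1 s dvd c * (b - (a * w2 + b * w4))"
      unfolding c' using rs by (metis monom_dvd_le mult_pCons_left smult_0_left add_0)
    hence "Polynomial.monom 1 s dvd 1 * (c * (b - (a * w2 + b * w4))) - a * (d - (c * w2 + d * w4)) - (a * d - b * c - 1) * e4"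
      using eqs D[of s] by (intro dvd_lincomb) auto
    also have "\<dots> = e4" by (simp add: w algebra_simps)
    finally show ?thesis .
  qed
  have 2: "Polynomial.monom 1 r dvd w2"
  proof -
    have "Polynomial.monom 1 r dvd b * (d - (c * w2 + d * w4)) - d * (b - (a * w2 + b * w4)) - (a * d - b * c - 1) * w2"
      using eqs D[of r] rs monom_dvd_le[of r s] by (intro dvd_lincomb) auto
    also have "\<dots> = w2" by (simp add: w algebra_simps)
    finally show ?thesis .
  qed
  have "Polynomial.monom 1 (r + s) dvd w2 * w3 - e1 * e4"
    using monom_dvd_mult[OF 2 3] monom_dvd_le[OF _ monom_dvd_mult[OF 1 4], of "r + s"] rs
    by (intro dvd_diff) auto
  also have "w2 * w3 - e1 * e4 = e1 + e4"
    using det by (simp add: w algebra_simps)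
  finally have "coeff (e1 + e4) k = 0" using k by (simp add: monom_1_dvd_iff')
  moreover have "coeff w1 k = coeff e1 k" "coeff w4 k = coeff e4 k"
    unfolding w coeff_add using k by simp_all
  ultimately show ?thesis by simp
qed

text \<open>The product W of the letters is kept as an exact polynomial matrix; only its effect on
  \<open>\<phi> 0\<close> is truncated. Each pair of letters raises the degree of w4 by exactly one,
  multiplying its leading coefficient by x * y, while w1 stays of smaller degree. The trace
  therefore has a nonzero coefficient at t^k, against \<open>mat_word_returns_imp\<close>.\<close>

lemma mat_no_closed_word:
  fixes \<phi> :: "nat \<Rightarrow> 'a::field quad"
  assumes rs: "r \<le> s" "s \<le> Suc r" and k: "0 < k" "k < r + s"
    and \<phi>0: "\<phi> 0 \<in> flags F s r"
    and step: "\<And>i. i < k \<Longrightarrow> \<exists>x\<in>F-{0}. \<exists>y\<in>F-{0}. \<phi> (Suc i) = mat_upper s r x (mat_lower s y (\<phi> i))"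
  shows "\<phi> k \<noteq> \<phi> 0"
proof
  assume eq: "\<phi> k = \<phi> 0"
  obtain a b c d where u: "\<phi> 0 = (a, b, c, d)" by (cases "\<phi> 0")
  have U: "coeff c 0 = 0" "Polynomial.monom 1 s dvd a * d - b * c - 1"
    using \<phi>0 unfolding flags_def u by auto
  \<comment> \<open>Besides the congruence with the product of \<open>\<phi> 0\<close> and W, the
    invariant records the degrees: below i for w1 and w2, at most i for w3, exactly i for w4. The
    guard \<open>j \<ge> 1\<close> allows for the constant w1 = 1 at i = 0.\<close>
  define good where "good i \<longleftrightarrow> (\<exists>w1 w2 w3 w4 a' b' c' d'. w1 * w4 - w2 * w3 = 1 \<and> \<phi> i = (a', b', c', d') \<and>
      Polynomial.monom 1 s dvd a' - (a * w1 + b * w3) \<and> Polynomial.monom 1 r dvd b' - (a * w2 + b * w4) \<and>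
      Polynomial.monom 1 s dvd c' - (c * w1 + d * w3) \<and> Polynomial.monom 1 s dvd d' - (c * w2 + d * w4) \<and>
      (\<forall>j\<ge>i. j \<ge> 1 \<longrightarrow> coeff w1 j = 0) \<and> (\<forall>j\<ge>i. coeff w2 j = 0) \<and>
      (\<forall>j>i. coeff w3 j = 0 \<and> coeff w4 j = 0) \<and> coeff w4 i \<noteq> 0)" for i
  have "good i" if "i \<le> k" for i
    using that
  proof (induction i)
    case 0
    show ?case unfolding good_def u
      by (rule exI[of _ 1], rule exI[of _ 0], rule exI[of _ 0], rule exI[of _ 1])
         (auto simp: coeff_1)
  next
    case (Suc i)
    then obtain w1 w2 w3 w4 a' b' c' d' where IH: "w1 * w4 - w2 * w3 = 1" "\<phi> i = (a', b', c', d')"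
      "Polynomial.monom 1 s dvd a' - (a * w1 + b * w3)" "Polynomial.monom 1 r dvd b' - (a * w2 + b * w4)"
      "Polynomial.monom 1 s dvd c' - (c * w1 + d * w3)" "Polynomial.monom 1 s dvd d' - (c * w2 + d * w4)"
      "\<And>j. j \<ge> i \<Longrightarrow> j \<ge> 1 \<Longrightarrow> coeff w1 j = 0" "\<And>j. j \<ge> i \<Longrightarrow> coeff w2 j = 0"
      "\<And>j. j > i \<Longrightarrow> coeff w3 j = 0" "\<And>j. j > i \<Longrightarrow> coeff w4 j = 0" "coeff w4 i \<noteq> 0"
      unfolding good_def by auto
    obtain x y where xy: "x \<in> F-{0}" "y \<in> F-{0}" "\<phi> (Suc i) = mat_upper s r x (mat_lower s y (\<phi> i))"
      using step[of i] Suc.prems by auto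
    define v1 v3 where "v1 = w1 + Polynomial.smult y (pCons 0 w2)" and "v3 = w3 + Polynomial.smult y (pCons 0 w4)"
    define v2 v4 where "v2 = w2 + Polynomial.smult x v1" and "v4 = w4 + Polynomial.smult x v3"
    define a2 c2 where "a2 = poly_cutoff s (a' + Polynomial.smult y (pCons 0 b'))"
      and "c2 = poly_cutoff s (c' + Polynomial.smult y (pCons 0 d'))"
    define b2 d2 where "b2 = poly_cutoff r (b' + Polynomial.smult x a2)" and "d2 = poly_cutoff s (d' + Polynomial.smult x c2)"
    have \<phi>: "\<phi> (Suc i) = (a2, b2, c2, d2)" unfolding xy(3) IH(2) a2_def b2_def c2_def d2_def by simp
    have det: "v1 * v4 - v2 * v3 = 1"
      unfolding v2_def v4_def v1_def v3_def using IH(1) by (simp add: algebra_simps smult_add_right)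
    define t :: "'a poly" where "t = [:0, 1:]"
    have pC: "pCons 0 p = t * p" for p unfolding t_def by simp
    have sm: "Polynomial.smult z p = [:z:] * (p :: 'a poly)" for z p by simp
    \<comment> \<open>\<open>b'\<close> is known only modulo t^r, but it enters the first column
      with a factor t.\<close>
    have bound: "Polynomial.monom 1 s dvd pCons 0 (b' - (a * w2 + b * w4))"
      using monom_dvd_pCons[OF IH(4)] rs monom_dvd_le by blast
    have a2: "Polynomial.monom 1 s dvd a2 - (a * v1 + b * v3)"
    proof -
      have "Polynomial.monom 1 s dvd (a2 - (a' + Polynomial.smult y (pCons 0 b'))) + (a' - (a * w1 + b * w3))
          + Polynomial.smult y (pCons 0 (b' - (a * w2 + b * w4)))"
        using IH bound unfolding a2_def
        by (intro dvd_add dvd_smult monom_dvd_poly_cutoff_diff) auto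
      also have "\<dots> = a2 - (a * v1 + b * v3)"
        unfolding v1_def v3_def pC sm by (simp add: algebra_simps)
      finally show ?thesis .
    qed
    have c2: "Polynomial.monom 1 s dvd c2 - (c * v1 + d * v3)"
    proof -
      have "Polynomial.monom 1 s dvd pCons 0 (d' - (c * w2 + d * w4))"
        using IH(6) monom_dvd_pCons monom_dvd_le by (metis le_SucI order_refl)
      hence "Polynomial.monom 1 s dvd (c2 - (c' + Polynomial.smult y (pCons 0 d'))) + (c' - (c * w1 + d * w3))
          + Polynomial.smult y (pCons 0 (d' - (c * w2 + d * w4)))"
        using IH unfolding c2_def
        by (intro dvd_add dvd_smult monom_dvd_poly_cutoff_diff) auto
      also have "\<dots> = c2 - (c * v1 + d * v3)"
        unfolding v1_def v3_def pC sm by (simp add: algebra_simps)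
      finally show ?thesis .
    qed
    have b2: "Polynomial.monom 1 r dvd b2 - (a * v2 + b * v4)"
    proof -
      have "Polynomial.monom 1 r dvd (b2 - (b' + Polynomial.smult x a2)) + (b' - (a * w2 + b * w4))
          + Polynomial.smult x (a2 - (a * v1 + b * v3))"
        using IH a2 monom_dvd_le[OF rs(1)] unfolding b2_def
        by (intro dvd_add dvd_smult monom_dvd_poly_cutoff_diff) auto
      also have "\<dots> = b2 - (a * v2 + b * v4)"
        unfolding v2_def v4_def pC sm by (simp add: algebra_simps)
      finally show ?thesis .
    qed
    have d2: "Polynomial.monom 1 s dvd d2 - (c * v2 + d * v4)"
    proof -
      have "Polynomial.monom 1 s dvd (d2 - (d' + Polynomial.smult x c2)) + (d' - (c * w2 + d * w4))
          + Polynomial.smult x (c2 - (c * v1 + d * v3))"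
        using IH c2 unfolding d2_def
        by (intro dvd_add dvd_smult monom_dvd_poly_cutoff_diff) auto
      also have "\<dots> = d2 - (c * v2 + d * v4)"
        unfolding v2_def v4_def pC sm by (simp add: algebra_simps)
      finally show ?thesis .
    qed
    have z1: "coeff v1 j = 0" if "j \<ge> Suc i" for j
      using that IH(7)[of j] IH(8)[of "j - 1"] unfolding v1_def by (cases j) auto
    have z2: "coeff v2 j = 0" if "j \<ge> Suc i" for j
      using that z1[of j] IH(8)[of j] unfolding v2_def by auto
    have z3: "coeff v3 j = 0" if "j > Suc i" for j
      using that IH(9)[of j] IH(10)[of "j - 1"] unfolding v3_def by (cases j) auto
    have z4: "coeff v4 j = 0" if "j > Suc i" for j
      using that z3[of j] IH(10)[of j] unfolding v4_def by auto
    have "coeff v4 (Suc i) \<noteq> 0"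
      using IH(9,10)[of "Suc i"] IH(11) xy(1,2) unfolding v4_def v3_def by simp
    thus ?case unfolding good_def using det \<phi> a2 b2 c2 d2 z1 z2 z3 z4 by blast
  qed
  from this[of k] obtain w1 w2 w3 w4 where W: "w1 * w4 - w2 * w3 = 1"
      "Polynomial.monom 1 s dvd a - (a * w1 + b * w3)" "Polynomial.monom 1 r dvd b - (a * w2 + b * w4)"
      "Polynomial.monom 1 s dvd c - (c * w1 + d * w3)" "Polynomial.monom 1 s dvd d - (c * w2 + d * w4)"
      "coeff w1 k = 0" "coeff w4 k \<noteq> 0"
    using k(1) unfolding good_def eq u by (auto simp: Suc_le_eq)
  have "coeff (w1 + w4) k = 0"
    by (rule mat_word_returns_imp[OF rs k U(2,1) W(1-5)])
  thus False using W(6,7) by simp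
qed

section \<open>Size of the congruence quotient\<close>

lemma flags_det_unique:
  fixes d d' :: "'a::field poly"
  assumes "coeffs_in F s d" "coeffs_in F s d'" "coeff a 0 = 1"
    and "Polynomial.monom 1 s dvd a * d - b * c - 1" "Polynomial.monom 1 s dvd a * d' - b * c - 1"
  shows "d = d'"
proof -
  have "Polynomial.monom 1 s dvd (a * d - b * c - 1) - (a * d' - b * c - 1)"
    using assms(4,5) by (rule dvd_diff)
  also have "(a * d - b * c - 1) - (a * d' - b * c - 1) = a * (d - d')" by (simp add: algebra_simps)
  finally have "\<forall>i<s. coeff (a * (d - d')) i = 0" by (simp add: monom_1_dvd_iff')
  \<comment> \<open>\<open>a\<close> has constant term 1, so it is a unit modulo t^s; concretely,
    the coefficients of d - d' vanish one after the other.\<close>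
  have "coeff (d - d') i = 0" for i
  proof (induction i rule: less_induct)
    case (less i)
    show ?case
    proof (cases "i < s")
      case True
      have "coeff (a * (d - d')) i = (\<Sum>j\<le>i. coeff a j * coeff (d - d') (i - j))"
        by (rule coeff_mult)
      also have "\<dots> = (\<Sum>j\<in>{0}. coeff a j * coeff (d - d') (i - j))"
        using less by (intro sum.mono_neutral_right) auto
      also have "\<dots> = coeff (d - d') i" using assms(3) by simp
      finally show ?thesis using True \<open>\<forall>i<s. _ i = 0\<close> by simp
    qed (use assms(1,2) in \<open>simp add: coeffs_in_def\<close>)
  qed
  thus ?thesis by (metis eq_iff_diff_eq_0 leading_coeff_0_iff)
qed

lemma coeffs_in_le_image:
  "{p. coeffs_in F n p} \<subseteq> Poly ` {xs. set xs \<subseteq> F \<and> length xs = n}"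
proof
  fix p assume p: "p \<in> {p. coeffs_in F n p}"
  have "p = Poly (map (coeff p) [0..<n])"
    using p by (intro poly_eqI) (auto simp: coeffs_in_def nth_default_def)
  thus "p \<in> Poly ` {xs. set xs \<subseteq> F \<and> length xs = n}"
    using p by (intro image_eqI[of _ _ "map (coeff p) [0..<n]"]) (auto simp: coeffs_in_def)
qed

lemma
  assumes "finite F"
  shows finite_coeffs_in: "finite {p. coeffs_in F n p}"
    and card_coeffs_in: "card {p. coeffs_in F n p} \<le> card F ^ n"
  using finite_subset[OF coeffs_in_le_image[of F n]] surj_card_le[OF _ coeffs_in_le_image[of F n]]
    finite_lists_length_eq[OF assms, of n] card_lists_length_eq[OF assms, of n] by auto

lemma
  assumes "finite F" "1 \<le> s"
  shows finite_coeffs_in_fixed: "finite {p. coeffs_in F s p \<and> coeff p 0 = z}"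
    and card_coeffs_in_fixed: "card {p. coeffs_in F s p \<and> coeff p 0 = z} \<le> card F ^ (s - 1)"
proof -
  have sub: "{p. coeffs_in F s p \<and> coeff p 0 = z} \<subseteq> pCons z ` {p. coeffs_in F (s - 1) p}"
  proof
    fix p assume p: "p \<in> {p. coeffs_in F s p \<and> coeff p 0 = z}"
    then obtain p' where p': "p = pCons z p'" by (cases p) auto
    have "coeff p' i \<in> F" for i
    proof -
      have "coeff p (Suc i) \<in> F" using p by (auto simp: coeffs_in_def)
      thus ?thesis unfolding p' by simp
    qed
    moreover have "coeff p' i = 0" if "i \<ge> s - 1" for i
    proof -
      have "coeff p (Suc i) = 0" using p that by (auto simp: coeffs_in_def)
      thus ?thesis unfolding p' by simp
    qed
    ultimately show "p \<in> pCons z ` {p. coeffs_in F (s - 1) p}"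
      unfolding p' by (auto simp: coeffs_in_def)
  qed
  show "finite {p. coeffs_in F s p \<and> coeff p 0 = z}"
    using finite_subset[OF sub] finite_coeffs_in[OF assms(1)] by blast
  show "card {p. coeffs_in F s p \<and> coeff p 0 = z} \<le> card F ^ (s - 1)"
    using surj_card_le[OF finite_coeffs_in[OF assms(1)] sub] card_coeffs_in[OF assms(1), of "s - 1"]
    by linarith
qed

text \<open>The determinant condition recovers \<open>d\<close> from the other entries, and the
  constant terms of \<open>a\<close> and \<open>c\<close> are prescribed. This leaves s - 1, r and s
  - 1 free coefficients.\<close>

lemma
  fixes F :: "'a::field set"
  assumes "finite F" "1 \<le> s"
  shows finite_flags: "finite (flags F s r)"
    and card_flags: "card (flags F s r) \<le> card F ^ ((s - 1) + r + (s - 1))"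
proof -
  define A where "A z = {p. coeffs_in F s p \<and> coeff p 0 = z}" for z :: 'a
  define B where "B = {p. coeffs_in F r p}"
  define f where "f = (\<lambda>(a :: 'a poly, b :: 'a poly, c :: 'a poly, d :: 'a poly). (a, b, c))"
  have inj: "inj_on f (flags F s r)"
    unfolding inj_on_def f_def flags_def using flags_det_unique by auto
  have sub: "f ` flags F s r \<subseteq> A 1 \<times> B \<times> A 0"
    unfolding f_def flags_def A_def B_def by auto
  have fin: "finite (A 1 \<times> B \<times> A 0)"
    unfolding A_def B_def using finite_coeffs_in_fixed[OF assms] finite_coeffs_in[OF assms(1)] by auto
  show "finite (flags F s r)" using inj sub fin by (meson finite_subset inj_on_finite)
  have "card (flags F s r) \<le> card (A 1 \<times> B \<times> A 0)"
    using inj sub fin by (metis card_inj_on_le)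
  also have "\<dots> \<le> card F ^ (s - 1) * (card F ^ r * card F ^ (s - 1))"
    unfolding card_cartesian_product A_def B_def
    by (intro mult_mono card_coeffs_in_fixed card_coeffs_in assms) auto
  finally show "card (flags F s r) \<le> card F ^ ((s - 1) + r + (s - 1))"
    by (simp add: power_add mult.assoc)
qed

lemma poly_cutoff_id: "coeffs_in F n p \<Longrightarrow> poly_cutoff n p = p"
  by (intro poly_eqI) (auto simp: coeffs_in_def coeff_poly_cutoff)

text \<open>The bounds \<open>1 \<le> r\<close> and \<open>2 \<le> s\<close> keep the coefficients
  read by \<open>flag_X\<close> and \<open>flag_Y\<close> below the cutoffs;
  \<open>k < r + s\<close> is what the trace argument asks for.\<close>

lemma flag_system_flags:
  fixes F :: "'a::field set"
  assumes F: "subring_set F" "finite F" and rs: "1 \<le> r" "r \<le> s" "s \<le> Suc r" "2 \<le> s"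
    and k: "0 < k" "k < r + s"
  shows "flag_system (flags F s r) F (mat_upper s r) (mat_lower s) flag_X flag_Y k"
proof
  note up = mat_upper_in_flags[OF F(1) rs(1-3)] and low = mat_lower_in_flags[OF F(1) rs(4)]
  show "finite (flags F s r)" using finite_flags[OF F(2)] rs by simp
  show "0 \<in> F" "\<And>x y. x \<in> F \<Longrightarrow> y \<in> F \<Longrightarrow> x - y \<in> F"
    using F(1) by (auto simp: subring_set_def)
  have "(1, 0, 0, 1) \<in> flags F s r"
    using F(1) rs by (auto simp: flags_def coeffs_in_def subring_set_def coeff_1)
  thus "flags F s r \<noteq> {}" by blast
  show "\<And>x u. u \<in> flags F s r \<Longrightarrow> x \<in> F \<Longrightarrow> mat_upper s r x u \<in> flags F s r"
    "\<And>x u. u \<in> flags F s r \<Longrightarrow> x \<in> F \<Longrightarrow> mat_lower s x u \<in> flags F s r"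
    using up low by auto
  show "\<And>u. u \<in> flags F s r \<Longrightarrow> flag_X u \<in> F" "\<And>u. u \<in> flags F s r \<Longrightarrow> flag_Y u \<in> F"
    by (auto simp: flags_def coeffs_in_def)
  show "\<And>u. u \<in> flags F s r \<Longrightarrow> mat_upper s r 0 u = u"
    "\<And>u. u \<in> flags F s r \<Longrightarrow> mat_lower s 0 u = u"
    by (auto simp: flags_def poly_cutoff_id)
  show "\<And>x y u. u \<in> flags F s r \<Longrightarrow> x \<in> F \<Longrightarrow> y \<in> F \<Longrightarrow>
      mat_upper s r x (mat_upper s r y u) = mat_upper s r (x + y) u"
    "\<And>x y u. u \<in> flags F s r \<Longrightarrow> x \<in> F \<Longrightarrow> y \<in> F \<Longrightarrow>
      mat_lower s x (mat_lower s y u) = mat_lower s (x + y) u"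
    by (auto simp: poly_eq_iff coeff_poly_cutoff coeff_pCons algebra_simps split: nat.splits)
  show "\<And>x u. u \<in> flags F s r \<Longrightarrow> x \<in> F \<Longrightarrow> flag_X (mat_upper s r x u) = flag_X u + x"
    "\<And>x u. u \<in> flags F s r \<Longrightarrow> x \<in> F \<Longrightarrow> flag_Y (mat_upper s r x u) = flag_Y u"
    "\<And>x u. u \<in> flags F s r \<Longrightarrow> x \<in> F \<Longrightarrow> flag_X (mat_lower s x u) = flag_X u"
    "\<And>x u. u \<in> flags F s r \<Longrightarrow> x \<in> F \<Longrightarrow> flag_Y (mat_lower s x u) = flag_Y u + x"
    using rs by (auto simp: flags_def coeff_poly_cutoff)
  show "\<phi> k \<noteq> \<phi> 0" if "\<And>i. i \<le> k \<Longrightarrow> \<phi> i \<in> flags F s r"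
    "\<And>i. i < k \<Longrightarrow> \<exists>x\<in>F - {0}. \<exists>y\<in>F - {0}. \<phi> (Suc i) = mat_upper s r x (mat_lower s y (\<phi> i))" for \<phi>
    using mat_no_closed_word[OF rs(2,3) k, of \<phi> F] that by blast
qed

lemma exists_flag_system:
  assumes "j > 0" "k \<ge> 2"
  shows "\<exists>(U :: gf2 alg_closure quad set) (F :: gf2 alg_closure set) al be xc yc. flag_system U F al be xc yc k \<and>
    finite F \<and> card F = 2 ^ j \<and> card U \<le> (2 ^ j) ^ (k + k div 2)"
proof -
  obtain F :: "gf2 alg_closure set" where F: "subring_set F" "finite F" "card F = 2 ^ j"
    using subfield_gf2_alg_closure[OF assms(1)] by blast
  \<comment> \<open>A balanced choice with r + s = k + 1, the least sum exceeding k; the number of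
    free coefficients then comes to k + k div 2.\<close>
  define s r where "s = k div 2 + 1" and "r = (k + 1) div 2"
  have rs: "1 \<le> r" "r \<le> s" "s \<le> Suc r" "2 \<le> s" and k: "0 < k" "k < r + s"
    unfolding s_def r_def using assms(2) by linarith+
  have "card (flags F s r) \<le> card F ^ ((s - 1) + r + (s - 1))"
    using card_flags[OF F(2)] rs by simp
  also have "(s - 1) + r + (s - 1) = k + k div 2"
    unfolding s_def r_def by linarith
  finally have "card (flags F s r) \<le> (2 ^ j) ^ (k + k div 2)" unfolding F(3) .
  thus ?thesis using flag_system_flags[OF F(1,2) rs k] F(2,3) by (intro exI conjI) assumption+
qed

subsection \<open>A layered graph without short closed walks\<close>

text \<open>A closed walk of length m is given by m-periodic functions on the naturals, so that the
  condition on consecutive edges covers the closing point without arithmetic modulo m.\<close>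

locale layered_graph =
  fixes V :: "'v set" and E :: "'e set" and tail head :: "'e \<Rightarrow> 'v"
    and lay :: "'v \<Rightarrow> nat" and L d m :: nat
  assumes finite_V: "finite V" and finite_E: "finite E"
    and lay_less: "\<And>v. v \<in> V \<Longrightarrow> lay v < L"
    and tail_in: "\<And>e. e \<in> E \<Longrightarrow> tail e \<in> V"
    and head_in: "\<And>e. e \<in> E \<Longrightarrow> head e \<in> V"
    and lay_head: "\<And>e. e \<in> E \<Longrightarrow> lay (head e) = Suc (lay (tail e))"
    and out_degree: "\<And>v. v \<in> V \<Longrightarrow> Suc (lay v) < L \<Longrightarrow> card {e \<in> E. tail e = v} = d"
    and in_degree: "\<And>v. v \<in> V \<Longrightarrow> 0 < lay v \<Longrightarrow> card {e \<in> E. head e = v} = d"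
    and edge_eqI: "\<And>e e'. e \<in> E \<Longrightarrow> e' \<in> E \<Longrightarrow> tail e = tail e' \<Longrightarrow> head e = head e' \<Longrightarrow> e = e'"
    and no_closed_walk: "\<And>es vs. (\<And>i. es i \<in> E) \<Longrightarrow>
      (\<And>i. {vs i, vs (Suc i)} = {tail (es i), head (es i)}) \<Longrightarrow> (\<And>i. es (Suc i) \<noteq> es i) \<Longrightarrow>
      (\<And>i. es (i + m) = es i) \<Longrightarrow> (\<And>i. vs (i + m) = vs i) \<Longrightarrow> False"

section \<open>The coset graph cut into coloured layers\<close>

context flag_system
begin

text \<open>Layers alternate between al-orbits (even) and be-orbits (odd). The colour \<^term>\<open>col j\<close> is constant
  on the orbits used in layer j, and \<^term>\<open>move j\<close> shifts the other colour.\<close>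

definition col :: "nat \<Rightarrow> 'u \<Rightarrow> 'a" where "col j u = (if even j then yc u else xc u)"
definition move :: "nat \<Rightarrow> 'a \<Rightarrow> 'u \<Rightarrow> 'u" where "move j x u = (if even j then al x u else be x u)"
text \<open>The representative of the orbit of u whose shifted colour is 0, so that an orbit can be
  named by a single flag.\<close>

definition proj :: "nat \<Rightarrow> 'u \<Rightarrow> 'u" where "proj j u = move j (- col (Suc j) u) u"

lemma col_Suc_Suc [simp]: "col (Suc (Suc j)) = col j"
  by (simp add: col_def fun_eq_iff)

lemma uminus_F: "x \<in> F \<Longrightarrow> - x \<in> F"
  using diff_F[OF zero_F] by simp

lemma col_in: "u \<in> U \<Longrightarrow> col j u \<in> F"
  by (simp add: col_def xc_in yc_in)

lemma move_in: "u \<in> U \<Longrightarrow> x \<in> F \<Longrightarrow> move j x u \<in> U"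
  by (simp add: move_def al_in be_in)

lemma move_0: "u \<in> U \<Longrightarrow> move j 0 u = u"
  by (simp add: move_def al_0 be_0)

lemma move_add: "u \<in> U \<Longrightarrow> x \<in> F \<Longrightarrow> y \<in> F \<Longrightarrow> move j x (move j y u) = move j (x + y) u"
  by (simp add: move_def al_add be_add)

lemma col_move: "u \<in> U \<Longrightarrow> x \<in> F \<Longrightarrow> col j (move j x u) = col j u"
  by (simp add: move_def col_def yc_al xc_be)

lemma col_Suc_move: "u \<in> U \<Longrightarrow> x \<in> F \<Longrightarrow> col (Suc j) (move j x u) = col (Suc j) u + x"
  by (simp add: move_def col_def xc_al yc_be)

lemma proj_in: "u \<in> U \<Longrightarrow> proj j u \<in> U"
  unfolding proj_def by (intro move_in uminus_F col_in)

lemma col_proj: "u \<in> U \<Longrightarrow> col j (proj j u) = col j u"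
  unfolding proj_def by (intro col_move uminus_F col_in)

lemma col_Suc_proj: "u \<in> U \<Longrightarrow> col (Suc j) (proj j u) = 0"
  unfolding proj_def by (subst col_Suc_move) (auto intro: uminus_F col_in)

lemma move_proj: "u \<in> U \<Longrightarrow> x \<in> F \<Longrightarrow> move j x (proj j u) = move j (x - col (Suc j) u) u"
  unfolding proj_def by (subst move_add) (auto intro: uminus_F col_in)

lemma move_col_proj: "u \<in> U \<Longrightarrow> move j (col (Suc j) u) (proj j u) = u"
  using move_proj[of u "col (Suc j) u" j] move_0[of u j] col_in by simp

lemma proj_move:
  assumes "u \<in> U" "x \<in> F" "col (Suc j) u = 0"
  shows "proj j (move j x u) = u"
proof -
  have "col (Suc j) (move j x u) = x" using col_Suc_move[OF assms(1,2), of j] assms(3) by simp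
  hence "proj j (move j x u) = move j (- x + x) u"
    unfolding proj_def using move_add[OF assms(1) uminus_F[OF assms(2)] assms(2)] by metis
  thus ?thesis using move_0[OF assms(1)] by (simp only: left_minus)
qed

lemma orbit_eq:
  assumes "w \<in> U" "col (Suc j) w = 0" "S \<subseteq> F"
  shows "{u \<in> U. proj j u = w \<and> col (Suc j) u \<in> S} = (\<lambda>x. move j x w) ` S"
proof (intro equalityI subsetI)
  fix u assume "u \<in> {u \<in> U. proj j u = w \<and> col (Suc j) u \<in> S}"
  thus "u \<in> (\<lambda>x. move j x w) ` S"
    using move_col_proj[of u j] by (intro image_eqI[of _ _ "col (Suc j) u"]) auto
next
  fix u assume "u \<in> (\<lambda>x. move j x w) ` S"
  thus "u \<in> {u \<in> U. proj j u = w \<and> col (Suc j) u \<in> S}"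
    using assms proj_move col_Suc_move move_in by fastforce
qed

text \<open>The shifted colour parametrises an orbit, so restricting it to a class \<open>S\<close>
  leaves exactly \<open>card S\<close> flags. This is the source of regularity.\<close>

lemma card_orbit:
  assumes "w \<in> U" "col (Suc j) w = 0" "S \<subseteq> F"
  shows "card {u \<in> U. proj j u = w \<and> col (Suc j) u \<in> S} = card S"
proof -
  have "inj_on (\<lambda>x. move j x w) S"
  proof (rule inj_onI)
    fix x y assume "x \<in> S" "y \<in> S" "move j x w = move j y w"
    hence "col (Suc j) w + x = col (Suc j) w + y"
      using assms col_Suc_move by (metis subsetD)
    thus "x = y" by simp
  qed
  thus ?thesis unfolding orbit_eq[OF assms] by (rule card_image)
qed

text \<open>A vertex consists of its layer, the index of one of \<open>c\<close> disjoint copies,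
  and the representative of an orbit.\<close>

definition base_V :: "(nat \<Rightarrow> 'a set) \<Rightarrow> nat \<Rightarrow> nat \<Rightarrow> (nat \<times> nat \<times> 'u) set" where
  "base_V S L c = {(j, i, v). j < L \<and> i < c \<and> v \<in> U \<and> col (Suc j) v = 0 \<and> col j v \<in> S j}"

text \<open>A flag joins its orbit in layer j to its orbit in layer j + 1. In layer j + 1 the
  shifted colour is again \<open>col j\<close>, so both degrees are sizes of colour classes.\<close>

definition base_E :: "(nat \<Rightarrow> 'a set) \<Rightarrow> nat \<Rightarrow> nat \<Rightarrow> (nat \<times> nat \<times> 'u) set" where
  "base_E S L c = {(j, i, u). Suc j < L \<and> i < c \<and> u \<in> U \<and> col j u \<in> S j \<and> col (Suc j) u \<in> S (Suc j)}"

definition base_tail :: "nat \<times> nat \<times> 'u \<Rightarrow> nat \<times> nat \<times> 'u" where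
  "base_tail = (\<lambda>(j, i, u). (j, i, proj j u))"

definition base_head :: "nat \<times> nat \<times> 'u \<Rightarrow> nat \<times> nat \<times> 'u" where
  "base_head = (\<lambda>(j, i, u). (Suc j, i, proj (Suc j) u))"

lemma incident_proj:
  assumes "(l, i, w) \<in> {base_tail (j, i', u), base_head (j, i', u)}"
  shows "i' = i" "proj l u = w" "l = j \<or> l = Suc j"
  using assms by (auto simp: base_tail_def base_head_def)

text \<open>Both flags lie in the orbit named by the common vertex, so they differ by a shift x. If
  x = 0, a single flag would serve both as an edge into layer l and as an edge out of it, putting
  one colour into two classes \<open>S\<close> of different layers.\<close>

lemma adjacent_edges_move:
  assumes S: "\<And>j. S j \<subseteq> F" "\<And>j j'. j \<noteq> j' \<Longrightarrow> S j \<inter> S j' = {}"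
    and e: "(j, i1, u) \<in> base_E S L c" "(j', i2, u') \<in> base_E S L c" "(j', i2, u') \<noteq> (j, i1, u)"
    and v: "(l, i, w) \<in> {base_tail (j, i1, u), base_head (j, i1, u)}"
      "(l, i, w) \<in> {base_tail (j', i2, u'), base_head (j', i2, u')}"
  shows "\<exists>x\<in>F-{0}. u' = move l x u"
proof -
  note p = incident_proj[OF v(1)] and p' = incident_proj[OF v(2)]
  have U: "u \<in> U" "u' \<in> U" using e by (auto simp: base_E_def)
  define x where "x = col (Suc l) u' - col (Suc l) u"
  have u': "u' = move l x u"
    using move_col_proj[OF U(2), of l] move_proj[OF U(1) col_in[OF U(2)], of l "Suc l"] p p'
    unfolding x_def by simp
  have "x \<noteq> 0"
  proof
    assume x: "x = 0"
    hence eq: "u' = u" using u' move_0[OF U(1)] by simp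
    hence "j \<noteq> j'" using p p' e(3) by auto
    hence "(l = j \<and> l = Suc j') \<or> (l = Suc j \<and> l = j')" using p(3) p'(3) by auto
    then obtain a where "Suc a = l" "col (Suc l) u \<in> S (Suc l)" "col a u \<in> S a"
      using e(1,2) unfolding eq base_E_def by auto
    moreover from this have "col a u = col (Suc l) u" by auto
    ultimately show False using S(2)[of a "Suc l"] by auto
  qed
  moreover have "x \<in> F" unfolding x_def using U by (intro diff_F col_in)
  ultimately show ?thesis using u' by blast
qed

lemma layered_graph_base:
  assumes S: "\<And>j. S j \<subseteq> F" "\<And>j j'. j \<noteq> j' \<Longrightarrow> S j \<inter> S j' = {}" "\<And>j. j < L \<Longrightarrow> card (S j) = d"
  shows "layered_graph (base_V S L c) (base_E S L c) base_tail base_head fst L d (2 * k)"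
proof
  have "base_V S L c \<subseteq> {..<L} \<times> {..<c} \<times> U" "base_E S L c \<subseteq> {..<L} \<times> {..<c} \<times> U"
    unfolding base_V_def base_E_def by auto
  thus "finite (base_V S L c)" "finite (base_E S L c)"
    using finite_U by (auto elim: finite_subset)
  show "\<And>v. v \<in> base_V S L c \<Longrightarrow> fst v < L" by (auto simp: base_V_def)
  show "\<And>e. e \<in> base_E S L c \<Longrightarrow> base_tail e \<in> base_V S L c"
    by (auto simp: base_E_def base_V_def base_tail_def proj_in col_Suc_proj col_proj)
  show "\<And>e. e \<in> base_E S L c \<Longrightarrow> base_head e \<in> base_V S L c"
    using col_Suc_proj[of _ "Suc _"]
    by (auto simp: base_E_def base_V_def base_head_def proj_in col_proj)
  show "\<And>e. fst (base_head e) = Suc (fst (base_tail e))"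
    by (auto simp: base_head_def base_tail_def)
  show "card {e \<in> base_E S L c. base_tail e = v} = d"
    if v: "v \<in> base_V S L c" "Suc (fst v) < L" for v
  proof -
    obtain j i w where w: "v = (j, i, w)" by (cases v)
    have "{e \<in> base_E S L c. base_tail e = v} =
        (\<lambda>u. (j, i, u)) ` {u \<in> U. proj j u = w \<and> col (Suc j) u \<in> S (Suc j)}"
      using v by (auto simp: w base_E_def base_V_def base_tail_def col_proj)
    moreover have "inj_on (\<lambda>u. (j, i, u)) A" for A :: "'u set" by (auto simp: inj_on_def)
    ultimately show ?thesis using card_orbit[of w j "S (Suc j)"] S v
      by (auto simp: w base_V_def card_image)
  qed
  show "card {e \<in> base_E S L c. base_head e = v} = d"
    if v: "v \<in> base_V S L c" "0 < fst v" for v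
  proof -
    obtain j i w where w: "v = (Suc j, i, w)" using v(2) by (cases v) (auto simp: gr0_conv_Suc)
    have "{e \<in> base_E S L c. base_head e = v} =
        (\<lambda>u. (j, i, u)) ` {u \<in> U. proj (Suc j) u = w \<and> col (Suc (Suc j)) u \<in> S j}"
      using v by (auto simp: w base_E_def base_V_def base_head_def col_proj)
    moreover have "inj_on (\<lambda>u. (j, i, u)) A" for A :: "'u set" by (auto simp: inj_on_def)
    ultimately show ?thesis using card_orbit[of w "Suc j" "S j"] S v
      by (auto simp: w base_V_def card_image)
  qed
  show "e = e'" if e: "e \<in> base_E S L c" "e' \<in> base_E S L c"
    "base_tail e = base_tail e'" "base_head e = base_head e'" for e e'
  proof -
    obtain j i u where u: "e = (j, i, u)" by (cases e)
    obtain u' where u': "e' = (j, i, u')"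
      using e(3) unfolding u by (cases e') (auto simp: base_tail_def)
    have U: "u \<in> U" "u' \<in> U" using e(1,2) unfolding u u' base_E_def by auto
    have p: "proj j u = proj j u'" "proj (Suc j) u = proj (Suc j) u'"
      using e(3,4) unfolding u u' base_tail_def base_head_def by auto
    \<comment> \<open>This colour is constant on the head orbit; within the tail orbit it singles
      out the flag.\<close>
    have "col (Suc j) u = col (Suc j) u'"
      using p(2) col_proj[OF U(1), of "Suc j"] col_proj[OF U(2), of "Suc j"] by simp
    hence "u = u'" using p(1) move_col_proj[OF U(1), of j] move_col_proj[OF U(2), of j] by metis
    thus ?thesis unfolding u u' by simp
  qed
  show False if es: "\<And>i. es i \<in> base_E S L c"
    and vs: "\<And>i. {vs i, vs (Suc i)} = {base_tail (es i), base_head (es i)}"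
    and ne: "\<And>i. es (Suc i) \<noteq> es i"
    and per: "\<And>i. es (i + 2 * k) = es i" "\<And>i. vs (i + 2 * k) = vs i" for es vs
  proof -
    define u where "u i = snd (snd (es i))" for i
    have U: "u i \<in> U" for i using es[of i] unfolding u_def base_E_def by auto
    have step: "\<exists>x\<in>F-{0}. u (Suc i) = move (fst (vs (Suc i))) x (u i)" for i
    proof -
      obtain l c' w where v: "vs (Suc i) = (l, c', w)" by (cases "vs (Suc i)")
      obtain j a b where e: "es i = (j, a, b)" by (cases "es i")
      obtain j' a' b' where e': "es (Suc i) = (j', a', b')" by (cases "es (Suc i)")
      have "(l, c', w) \<in> {base_tail (j, a, b), base_head (j, a, b)}"
        "(l, c', w) \<in> {base_tail (j', a', b'), base_head (j', a', b')}"
        using vs[of i] vs[of "Suc i"] unfolding v e e' by auto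
      from adjacent_edges_move[OF S(1,2) es[of i, unfolded e] es[of "Suc i", unfolded e']
          ne[of i, unfolded e e'] this]
      show ?thesis unfolding u_def v e e' by simp
    qed
    have parity: "even (fst (vs (Suc i))) \<longleftrightarrow> odd (fst (vs i))" for i
    proof -
      have "fst (base_head (es i)) = Suc (fst (base_tail (es i)))"
        by (cases "es i") (auto simp: base_head_def base_tail_def)
      thus ?thesis using vs[of i] by (auto simp: doubleton_eq_iff)
    qed
    \<comment> \<open>The offset starts the walk at an even layer. The first step then passes an odd
      layer and is a \<open>be\<close>-move, the second an \<open>al\<close>-move, as in the words
      of \<open>no_closed_word\<close>.\<close>
    define o' where "o' = (if even (fst (vs 0)) then 0 else 1 :: nat)"
    have par: "even (fst (vs (o' + i))) \<longleftrightarrow> even i" for i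
      by (induction i) (use parity[of 0] in \<open>auto simp: o'_def parity\<close>)
    define \<phi> where "\<phi> i = u (o' + 2 * i)" for i
    have "\<phi> k \<noteq> \<phi> 0"
    proof (rule no_closed_word)
      show "\<phi> i \<in> U" for i unfolding \<phi>_def using U by simp
      show "\<exists>x\<in>F - {0}. \<exists>y\<in>F - {0}. \<phi> (Suc i) = al x (be y (\<phi> i))" for i
      proof -
        obtain y where y: "y \<in> F - {0}" "u (Suc (o' + 2 * i)) = be y (u (o' + 2 * i))"
          using step[of "o' + 2 * i"] par[of "Suc (2 * i)"] by (auto simp: move_def)
        obtain x where x: "x \<in> F - {0}"
          "u (Suc (Suc (o' + 2 * i))) = al x (u (Suc (o' + 2 * i)))"
          using step[of "Suc (o' + 2 * i)"] par[of "Suc (Suc (2 * i))"] by (auto simp: move_def)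
        have "\<phi> (Suc i) = al x (be y (\<phi> i))" using x(2) y(2) unfolding \<phi>_def by simp
        thus ?thesis using x(1) y(1) by blast
      qed
    qed
    moreover have "\<phi> k = \<phi> 0" using per(1)[of o'] unfolding \<phi>_def u_def by simp
    ultimately show False by contradiction
  qed
qed

text \<open>Moving the representatives in layer 0 by the elements of \<open>S 1\<close> embeds pairs
  into \<open>U\<close>, which bounds their number w. Any flag can be moved to a colour in
  \<open>S 0\<close>, so w is positive.\<close>

lemma base_layer_0:
  assumes "S 0 \<subseteq> F" "S 1 \<subseteq> F" "S 0 \<noteq> {}" "0 < L"
  shows "\<exists>w>0. w * card (S 1) \<le> card U \<and> (\<forall>c. card {v \<in> base_V S L c. fst v = 0} = c * w)"
proof -
  define W where "W = {v \<in> U. col 1 v = 0 \<and> col 0 v \<in> S 0}"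
  have finW: "finite W" unfolding W_def using finite_U by simp
  have "inj_on (\<lambda>(v, x). move 0 x v) (W \<times> S 1)"
  proof (intro inj_onI, clarify)
    fix v x v' x' assume a: "v \<in> W" "x \<in> S 1" "v' \<in> W" "x' \<in> S 1" "move 0 x v = move 0 x' v'"
    hence m: "v \<in> U" "v' \<in> U" "x \<in> F" "x' \<in> F" "col (Suc 0) v = 0" "col (Suc 0) v' = 0"
      using assms unfolding W_def by auto
    have "v = v'" using proj_move[of v x 0] proj_move[of v' x' 0] m a(5) by simp
    moreover have "x = x'"
      using col_Suc_move[of v x 0] col_Suc_move[of v' x' 0] m a(5) by simp
    ultimately show "v = v' \<and> x = x'" by simp
  qed
  moreover have "(\<lambda>(v, x). move 0 x v) ` (W \<times> S 1) \<subseteq> U"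
    using assms by (auto simp: W_def intro!: move_in)
  ultimately have "card (W \<times> S 1) \<le> card U" using finite_U by (rule card_inj_on_le)
  hence le: "card W * card (S 1) \<le> card U" by (simp add: card_cartesian_product)
  obtain u s where u: "u \<in> U" "s \<in> S 0" using U_nonempty assms(3) by blast
  have s: "s - col 0 u \<in> F" using u assms by (intro diff_F col_in) auto
  define v where "v = move 1 (s - col 0 u) u"
  have v: "v \<in> U" "col 0 v = s"
    unfolding v_def using col_Suc_move[OF u(1) s, of 1] move_in[OF u(1) s] by auto
  have "proj 0 v \<in> W"
    unfolding W_def using v u col_Suc_proj[OF v(1), of 0] by (auto simp: proj_in col_proj)
  hence "card W > 0" using finW by (auto simp: card_gt_0_iff)
  have "{v \<in> base_V S L c. fst v = 0} = {0} \<times> {..<c} \<times> W" for c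
    unfolding base_V_def W_def using assms(4) by auto
  hence "card {v \<in> base_V S L c. fst v = 0} = c * card W" for c
    by (simp add: card_cartesian_product)
  with le \<open>card W > 0\<close> show ?thesis by blast
qed

end

text \<open>The colour classes are blocks of d consecutive elements in an enumeration of the field,
  empty from index L on. Since w does not depend on the number c of copies, c remains free for
  fitting the graph to n.\<close>

lemma exists_layered_graph:
  assumes "j > 0" "k \<ge> 2" "2 \<le> L" "L \<le> 2 ^ j"
  defines "d \<equiv> 2 ^ j div L"
  shows "\<exists>w>0. w * d \<le> (2 ^ j) ^ (k + k div 2) \<and>
    (\<forall>c. \<exists>V E tail head lay. layered_graph (V :: (nat \<times> nat \<times> gf2 alg_closure quad) set)
      (E :: (nat \<times> nat \<times> gf2 alg_closure quad) set) tail head lay L d (2 * k) \<and>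
      card {v \<in> V. lay v = 0} = c * w)"
proof -
  obtain U :: "gf2 alg_closure quad set" and F :: "gf2 alg_closure set" and al be xc yc
    where fs: "flag_system U F al be xc yc k"
      and F: "finite F" "card F = 2 ^ j" and U: "card U \<le> (2 ^ j) ^ (k + k div 2)"
    using exists_flag_system[OF assms(1,2)] by blast
  interpret flag_system U F al be xc yc k by (rule fs)
  obtain h where h: "bij_betw h {0..<card F} F" using ex_bij_betw_nat_finite[OF F(1)] by blast
  define S where "S i = (if i < L then h ` {i * d..<i * d + d} else {})" for i
  have le: "i * d + d \<le> card F" if "i < L" for i
  proof -
    have "i * d + d = (i + 1) * d" by simp
    also have "\<dots> \<le> L * d" using that by (intro mult_right_mono) auto
    also have "\<dots> \<le> card F" unfolding d_def F(2) by simp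
    finally show ?thesis .
  qed
  have sub: "{i * d..<i * d + d} \<subseteq> {0..<card F}" if "i < L" for i
    using le[OF that] by auto
  have S: "S i \<subseteq> F" for i
    using image_mono[OF sub, of i h] h unfolding S_def bij_betw_def by (cases "i < L") auto
  have card_S: "card (S i) = d" if "i < L" for i
    using that sub[OF that] h unfolding S_def bij_betw_def
    by (auto simp: card_image inj_on_subset)
  have disj: "S i \<inter> S i' = {}" if "i \<noteq> i'" for i i'
  proof (rule ccontr)
    assume "S i \<inter> S i' \<noteq> {}"
    then obtain y where y: "y \<in> S i" "y \<in> S i'" by blast
    hence L: "i < L" "i' < L" by (auto simp: S_def split: if_splits)
    have "S i = h ` {i * d..<i * d + d}" "S i' = h ` {i' * d..<i' * d + d}" using L by (simp_all add: S_def)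
    with y obtain x x' where x: "y = h x" "x \<in> {i * d..<i * d + d}"
      "y = h x'" "x' \<in> {i' * d..<i' * d + d}" by blast
    have "x \<in> {0..<card F}" "x' \<in> {0..<card F}" using x sub L by blast+
    hence "x = x'" using h x(1,3) unfolding bij_betw_def inj_on_def by metis
    moreover have "x div d = i" "x' div d = i'" using x by (auto intro!: div_nat_eqI simp: algebra_simps)
    ultimately show False using that by simp
  qed
  have d0: "d > 0" unfolding d_def using assms(3,4) by (simp add: div_greater_zero_iff)
  hence "S 0 \<noteq> {}" using card_S[of 0] assms(3) by auto
  from base_layer_0[of S, OF S S this, of L] obtain w
    where w: "w > 0" "w * card (S 1) \<le> card U" "\<And>c. card {v \<in> base_V S L c. fst v = 0} = c * w"
    using assms(3) by auto
  have "w * d \<le> (2 ^ j) ^ (k + k div 2)" using w(2) card_S[of 1] assms(3) U by simp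
  moreover have "layered_graph (base_V S L c) (base_E S L c) base_tail base_head fst L d (2 * k)" for c
    by (intro layered_graph_base S disj card_S)
  ultimately show ?thesis using w(1,3) by blast
qed

subsection \<open>Paths, cycles and counting\<close>

definition pairs :: "'a list \<Rightarrow> ('a \<times> 'a) set" where
  "pairs p = set (zip p (tl p))"

definition edges_of :: "('a \<times> 'a) set \<Rightarrow> 'a set set" where
  "edges_of R = {{x, y} | x y. (x, y) \<in> R}"

lemma pairs_Nil [simp]: "pairs [] = {}"
  by (simp add: pairs_def)

lemma pairs_append:
  "pairs (xs @ ys) = pairs xs \<union> pairs ys \<union> (if xs \<noteq> [] \<and> ys \<noteq> [] then {(last xs, hd ys)} else {})"
proof (induction xs)
  case (Cons x xs)
  show ?case
  proof (cases xs)
    case Nil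
    thus ?thesis by (cases ys) (auto simp: pairs_def)
  next
    case (Cons x' xs')
    have "pairs (x # zs) = insert (x, hd zs) (pairs zs)" if "zs \<noteq> []" for zs
      using that by (cases zs) (auto simp: pairs_def)
    from this[of "xs @ ys"] this[of xs] Cons.IH show ?thesis unfolding Cons by auto
  qed
qed (auto simp: pairs_def)

lemma pairs_map: "pairs (map f xs) = map_prod f f ` pairs xs"
  by (simp add: pairs_def zip_map_map[symmetric] map_tl[symmetric] map_prod_def del: zip_map_map)
     (metis list.set_map map_tl zip_map_map)

lemma pairs_conv_nth: "pairs p = {(p ! i, p ! Suc i) | i. Suc i < length p}"
  by (auto simp: pairs_def set_zip nth_tl)

lemma path_edges_conv_pairs: "path_edges p = edges_of (pairs p)"
  by (auto simp: path_edges_def edges_of_def pairs_conv_nth)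

lemma pairs_map_upt: "pairs (map f [a..<b]) = {(f i, f (Suc i)) | i. a \<le> i \<and> Suc i < b}"
proof (intro equalityI subsetI)
  fix x assume "x \<in> {(f i, f (Suc i)) | i. a \<le> i \<and> Suc i < b}"
  then obtain i where i: "x = (f i, f (Suc i))" "a \<le> i" "Suc i < b" by auto
  show "x \<in> pairs (map f [a..<b])"
    unfolding pairs_conv_nth using i by (intro CollectI exI[of _ "i - a"]) auto
qed (auto simp: pairs_conv_nth)

lemma pairs_concat:
  assumes "\<And>i. f i \<noteq> []"
  shows "pairs (concat (map f [0..<M])) =
    (\<Union>i<M. pairs (f i)) \<union> {(last (f i), hd (f (Suc i))) | i. Suc i < M}"
proof (induction M)
  case (Suc M)
  show ?case
  proof (cases M)
    case (Suc M')
    have ne: "concat (map f [0..<M]) \<noteq> []" using assms Suc by auto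
    have "last (concat (map f [0..<M])) = last (f M')" unfolding Suc using assms by simp
    hence "pairs (concat (map f [0..<Suc M])) =
        pairs (concat (map f [0..<M])) \<union> pairs (f M) \<union> {(last (f M'), hd (f M))}"
      using ne assms by (simp add: pairs_append)
    also have "\<dots> = (\<Union>i<Suc M. pairs (f i)) \<union> {(last (f i), hd (f (Suc i))) | i. Suc i < Suc M}"
      unfolding Suc.IH unfolding Suc by (auto simp: less_Suc_eq)
    finally show ?thesis .
  qed (simp add: lessThan_Suc)
qed simp

text \<open>The notion \<open>contains_cycle\<close> over an arbitrary vertex type, needed because
  the lifted graph is numbered by naturals only at the end.\<close>

definition has_cycle :: "'a set set \<Rightarrow> nat \<Rightarrow> bool" where
  "has_cycle G m \<longleftrightarrow> (\<exists>vs. length vs = m \<and> distinct vs \<and> (\<forall>i<m. {vs ! i, vs ! ((i + 1) mod m)} \<in> G))"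

lemma has_cycle_image:
  assumes "has_cycle ((`) f ` G) m" "inj_on f A" "\<And>e. e \<in> G \<Longrightarrow> e \<subseteq> A" "m > 0"
  shows "has_cycle G m"
proof -
  obtain vs where vs: "length vs = m" "distinct vs"
    "\<And>i. i < m \<Longrightarrow> {vs ! i, vs ! ((i + 1) mod m)} \<in> (`) f ` G"
    using assms(1) unfolding has_cycle_def by blast
  define g where "g = inv_into A f"
  have in_A: "vs ! i \<in> f ` A" if "i < m" for i
    using vs(3)[OF that] assms(3) by blast
  hence "distinct (map g vs)"
    using vs(1,2) unfolding g_def
    by (auto simp: distinct_map set_conv_nth intro!: inj_on_inv_into)
  moreover have "{map g vs ! i, map g vs ! ((i + 1) mod m)} \<in> G" if i: "i < m" for i
  proof -
    obtain e where e: "e \<in> G" "{vs ! i, vs ! ((i + 1) mod m)} = f ` e" using vs(3)[OF i] by blast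
    have "g ` f ` e = e" unfolding g_def using assms(2) assms(3)[OF e(1)] by (rule inv_into_image_cancel)
    hence "g ` {vs ! i, vs ! ((i + 1) mod m)} = e" unfolding e(2) .
    moreover have "(i + 1) mod m < m" using assms(4) by simp
    ultimately show ?thesis using e(1) i vs(1) by auto
  qed
  ultimately show ?thesis unfolding has_cycle_def using vs(1) by (metis length_map)
qed

lemma has_cycle_mono: "has_cycle G m \<Longrightarrow> G \<subseteq> G' \<Longrightarrow> has_cycle G' m"
  unfolding has_cycle_def by blast

lemma cycle_pred:
  assumes "i < (m::nat)"
  obtains i' where "i' < m" "(i' + 1) mod m = i"
proof (cases i)
  case 0
  thus ?thesis using assms by (intro that[of "m - 1"]) auto
next
  case (Suc j)
  thus ?thesis using assms by (intro that[of j]) auto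
qed

text \<open>On a cycle of length at least 3 a vertex has two distinct neighbours, which must be p
  and q if the graph offers no others.\<close>

lemma cycle_neighbours:
  assumes vs: "length vs = m" "distinct vs" "\<And>i. i < m \<Longrightarrow> {vs ! i, vs ! ((i + 1) mod m)} \<in> G"
    and m: "m \<ge> 3" and z: "z \<in> set vs" and nb: "\<And>y. {z, y} \<in> G \<Longrightarrow> y = p \<or> y = q"
  shows "p \<in> set vs" "q \<in> set vs"
proof -
  obtain i where i: "i < m" "vs ! i = z" using z vs(1) by (auto simp: in_set_conv_nth)
  obtain i' where i': "i' < m" "(i' + 1) mod m = i" using cycle_pred[OF i(1)] .
  define i'' where "i'' = (i + 1) mod m"
  have i'': "i'' < m" unfolding i''_def using m by simp
  have "i' \<noteq> i''"
  proof
    assume "i' = i''"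
    hence "(i + 2) mod m = i" using i'(2) unfolding i''_def by (simp add: mod_Suc_eq)
    hence "m dvd 2" using i(1) by (metis add_diff_cancel_left' le_add1 mod_eq_dvd_iff_nat mod_less)
    thus False using m by (auto dest: dvd_imp_le)
  qed
  hence "vs ! i' \<noteq> vs ! i''" using vs(1,2) i'(1) i'' by (simp add: nth_eq_iff_index_eq)
  moreover have "{z, vs ! i''} \<in> G" using vs(3)[OF i(1)] i(2) unfolding i''_def by simp
  moreover have "{z, vs ! i'} \<in> G" using vs(3)[OF i'(1)] i(2) i'(2) by (simp add: insert_commute)
  ultimately have "{p, q} \<subseteq> {vs ! i', vs ! i''}" using nb by blast
  thus "p \<in> set vs" "q \<in> set vs" using i'(1) i'' vs(1) by auto
qed

text \<open>On the fibre over each v in \<open>T\<close> there are d! injective labellings, and they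
  can be chosen independently and glued together.\<close>

lemma card_fibre_injective:
  assumes "finite E" "finite T" "\<And>v. v \<in> T \<Longrightarrow> card {e \<in> E. g e = v} = d" "g ` E \<subseteq> T"
  shows "fact d ^ card T \<le> card {a \<in> E \<rightarrow>\<^sub>E {..<d}. \<forall>v. inj_on a {e \<in> E. g e = v}}"
proof -
  define fib where "fib v = {e \<in> E. g e = v}" for v
  define P where "P v = {f \<in> fib v \<rightarrow>\<^sub>E {..<d}. inj_on f (fib v)}" for v
  have fin: "finite (fib v)" for v unfolding fib_def using assms(1) by simp
  have cardP: "card (P v) = fact d" if "v \<in> T" for v
  proof -
    have "card (P v) = prod ((-) d) {0..<d}"
      unfolding P_def using assms(3)[OF that] fin
      by (subst card_inj_on_subset_funcset) (auto simp: fib_def)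
    thus ?thesis by (simp add: fact_prod_rev)
  qed
  define \<Phi> where "\<Phi> F = (\<lambda>e\<in>E. F (g e) e)" for F :: "'b \<Rightarrow> 'a \<Rightarrow> nat"
  let ?A = "{a \<in> E \<rightarrow>\<^sub>E {..<d}. \<forall>v. inj_on a {e \<in> E. g e = v}}"
  have "\<Phi> ` PiE T P \<subseteq> ?A"
  proof (intro subsetI)
    fix a assume "a \<in> \<Phi> ` PiE T P"
    then obtain F where F: "F \<in> PiE T P" "a = \<Phi> F" by blast
    have FP: "F (g e) \<in> fib (g e) \<rightarrow>\<^sub>E {..<d}" "inj_on (F (g e)) (fib (g e))" if "e \<in> E" for e
      using F(1) that assms(4) unfolding P_def by (auto dest!: PiE_mem[of F T P "g e"])
    have "a e \<in> {..<d}" if "e \<in> E" for e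
      using FP(1)[OF that] that unfolding F(2) \<Phi>_def fib_def by (auto dest!: PiE_mem)
    moreover have "inj_on a {e \<in> E. g e = v}" for v
    proof (rule inj_onI)
      fix e e' assume e: "e \<in> {e \<in> E. g e = v}" "e' \<in> {e \<in> E. g e = v}" "a e = a e'"
      hence "F v e = F v e'" "inj_on (F v) (fib v)" using FP(2)[of e] unfolding F(2) \<Phi>_def by auto
      thus "e = e'" using e unfolding fib_def inj_on_def by auto
    qed
    ultimately show "a \<in> ?A" unfolding F(2) \<Phi>_def by auto
  qed
  moreover have "inj_on \<Phi> (PiE T P)"
  proof (rule inj_onI)
    fix F F' assume F: "F \<in> PiE T P" "F' \<in> PiE T P" "\<Phi> F = \<Phi> F'"
    show "F = F'"
    proof (rule PiE_ext[OF F(1,2)])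
      fix v assume v: "v \<in> T"
      have "F v \<in> fib v \<rightarrow>\<^sub>E {..<d}" "F' v \<in> fib v \<rightarrow>\<^sub>E {..<d}"
        using PiE_mem[OF F(1) v] PiE_mem[OF F(2) v] unfolding P_def by auto
      thus "F v = F' v"
      proof (rule PiE_ext)
        fix e assume "e \<in> fib v"
        thus "F v e = F' v e" using fun_cong[OF F(3), of e] unfolding \<Phi>_def fib_def by auto
      qed
    qed
  qed
  moreover have "finite ?A"
    using finite_PiE[OF assms(1), of "\<lambda>_. {..<d}"] by (rule rev_finite_subset) auto
  ultimately have "card (PiE T P) \<le> card ?A" by (intro card_inj_on_le)
  moreover have "card (PiE T P) = fact d ^ card T" using cardP assms(2) by (simp add: card_PiE)
  ultimately show ?thesis by simp
qed

text \<open>The largest fibre is at least the average one; the product form avoids division of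
  naturals.\<close>

lemma pigeonhole_fibre:
  assumes "finite A" "finite B" "B \<noteq> {}" "f ` A \<subseteq> B"
  shows "\<exists>y\<in>B. card A \<le> card B * card {x \<in> A. f x = y}"
proof (rule ccontr)
  assume neg: "\<not> ?thesis"
  have "card A = (\<Sum>y\<in>B. card {x \<in> A. f x = y})"
    using sum.group[OF assms(1,2,4), of "\<lambda>_. 1 :: nat"] by simp
  hence "card B * card A = (\<Sum>y\<in>B. card B * card {x \<in> A. f x = y})"
    by (simp add: sum_distrib_left)
  also have "\<dots> < (\<Sum>y\<in>B. card A)"
    using neg assms by (intro sum_strict_mono) (auto simp: not_le)
  finally show False by simp
qed

subsection \<open>Lifting the layered graph\<close>

lemma add_mod_left_cancel:
  assumes "(x + y) mod d = (x + y') mod d" "y < d" "y' < (d :: nat)"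
  shows "y = y'"
  using assms
proof (induction y y' rule: linorder_wlog)
  case (le y y')
  hence "d dvd y' - y" using mod_eq_dvd_iff_nat[of "x + y" "x + y'" d] by simp
  thus ?case using le by (auto dest: dvd_imp_le)
qed auto

context layered_graph
begin

definition layer :: "nat \<Rightarrow> 'v set" where
  "layer j = {v \<in> V. lay v = j}"

definition lift_layer :: "nat \<Rightarrow> ('v \<times> nat) set" where
  "lift_layer j = layer j \<times> {..<d}"

text \<open>With \<open>a\<close> injective around tails and \<open>b\<close> around heads, the arcs
  from (tail e, a e) to (head e, b e) form perfect matchings between consecutive lifted
  layers.\<close>

definition labellings :: "('e \<Rightarrow> 'v) \<Rightarrow> ('e \<Rightarrow> nat) set" where
  "labellings g = {a \<in> E \<rightarrow>\<^sub>E {..<d}. \<forall>v. inj_on a {e \<in> E. g e = v}}"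

text \<open>One step along the matching. The description is meaningful below the last layer, where
  exactly one outgoing edge carries the given label.\<close>

definition follow :: "('e \<Rightarrow> nat) \<Rightarrow> ('e \<Rightarrow> nat) \<Rightarrow> 'v \<times> nat \<Rightarrow> 'v \<times> nat" where
  "follow a b w = (let e = (THE e. e \<in> E \<and> tail e = fst w \<and> a e = snd w) in (head e, b e))"

definition lift_path :: "('e \<Rightarrow> nat) \<Rightarrow> ('e \<Rightarrow> nat) \<Rightarrow> 'v \<times> nat \<Rightarrow> ('v \<times> nat) list" where
  "lift_path a b x = map (\<lambda>j. (follow a b ^^ j) x) [0..<L]"

lemma finite_layer: "finite (layer j)"
  unfolding layer_def using finite_V by simp

lemma finite_lift_layer: "finite (lift_layer j)"
  unfolding lift_layer_def using finite_layer by simp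

lemma labelling_less: "a \<in> labellings g \<Longrightarrow> e \<in> E \<Longrightarrow> a e < d"
  unfolding labellings_def by (auto dest!: PiE_mem)

lemma labelling_inj:
  "a \<in> labellings g \<Longrightarrow> e \<in> E \<Longrightarrow> e' \<in> E \<Longrightarrow> g e = g e' \<Longrightarrow> a e = a e' \<Longrightarrow> e = e'"
  unfolding labellings_def inj_on_def by auto

lemma labelling_surj:
  assumes "a \<in> labellings g" "card {e \<in> E. g e = v} = d" "i < d"
  shows "\<exists>e\<in>E. g e = v \<and> a e = i"
proof -
  have inj: "inj_on a {e \<in> E. g e = v}" using assms(1) unfolding labellings_def by blast
  have "a ` {e \<in> E. g e = v} = {..<d}"
    using labelling_less[OF assms(1)] card_image[OF inj] assms(2)
    by (intro card_subset_eq) auto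
  hence "i \<in> a ` {e \<in> E. g e = v}" using assms(3) by simp
  thus ?thesis by blast
qed

lemma follow_eq:
  assumes "a \<in> labellings tail" "e \<in> E"
  shows "follow a b (tail e, a e) = (head e, b e)"
proof -
  have "(THE e'. e' \<in> E \<and> tail e' = tail e \<and> a e' = a e) = e"
    using assms labelling_inj[OF assms(1)] by (intro the_equality) auto
  thus ?thesis by (simp add: follow_def)
qed

lemma Suc_lay_tail_less: "e \<in> E \<Longrightarrow> Suc (lay (tail e)) < L"
  using lay_less[OF head_in] lay_head by simp

lemma tail_lift: "a \<in> labellings g \<Longrightarrow> e \<in> E \<Longrightarrow> (tail e, a e) \<in> lift_layer (lay (tail e))"
  by (auto simp: lift_layer_def layer_def labelling_less tail_in)

lemma head_lift: "b \<in> labellings g \<Longrightarrow> e \<in> E \<Longrightarrow> (head e, b e) \<in> lift_layer (Suc (lay (tail e)))"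
  by (auto simp: lift_layer_def layer_def labelling_less head_in lay_head)

lemma lift_layer_tailE:
  assumes "a \<in> labellings tail" "w \<in> lift_layer j" "Suc j < L"
  obtains e where "e \<in> E" "w = (tail e, a e)" "lay (tail e) = j"
  using assms labelling_surj[OF assms(1) out_degree, of "fst w" "snd w"] that
  unfolding lift_layer_def layer_def by (cases w) auto

lemma lift_layer_headE:
  assumes "b \<in> labellings head" "w \<in> lift_layer (Suc j)"
  obtains e where "e \<in> E" "w = (head e, b e)" "lay (tail e) = j"
proof -
  have "\<exists>e\<in>E. head e = fst w \<and> b e = snd w"
    using assms labelling_surj[OF assms(1) in_degree, of "fst w" "snd w"]
    unfolding lift_layer_def layer_def by auto
  then obtain e where "e \<in> E" "w = (head e, b e)" by auto
  thus ?thesis using assms(2) lay_head[of e] that unfolding lift_layer_def layer_def by auto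
qed

lemma follow_image:
  assumes "a \<in> labellings tail" "b \<in> labellings head" "Suc j < L"
  shows "follow a b ` lift_layer j = lift_layer (Suc j)"
proof (intro equalityI subsetI)
  fix w assume "w \<in> follow a b ` lift_layer j"
  then obtain w' where w': "w' \<in> lift_layer j" "w = follow a b w'" by blast
  from lift_layer_tailE[OF assms(1) w'(1) assms(3)] obtain e where
    e: "e \<in> E" "w' = (tail e, a e)" "lay (tail e) = j" .
  show "w \<in> lift_layer (Suc j)"
    using follow_eq[OF assms(1) e(1)] head_lift[OF assms(2) e(1)] w'(2) e by simp
next
  fix w assume "w \<in> lift_layer (Suc j)"
  from lift_layer_headE[OF assms(2) this] obtain e where
    e: "e \<in> E" "w = (head e, b e)" "lay (tail e) = j" .
  thus "w \<in> follow a b ` lift_layer j"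
    using follow_eq[OF assms(1) e(1)] tail_lift[OF assms(1) e(1)] by (metis imageI)
qed

lemma follow_pow_image:
  assumes "a \<in> labellings tail" "b \<in> labellings head" "j < L"
  shows "(follow a b ^^ j) ` lift_layer 0 = lift_layer j"
  using assms(3)
proof (induction j)
  case (Suc j)
  have "(follow a b ^^ Suc j) ` lift_layer 0 = follow a b ` (follow a b ^^ j) ` lift_layer 0"
    by (simp add: image_comp)
  thus ?case using Suc follow_image[OF assms(1,2)] by simp
qed simp

text \<open>The iterates of \<open>follow\<close> map layer 0 onto every later layer, so the paths
  that start in layer 0 use up all matching arcs.\<close>

lemma pairs_lift_paths:
  assumes "a \<in> labellings tail" "b \<in> labellings head"
  shows "(\<Union>x\<in>lift_layer 0. pairs (lift_path a b x)) = (\<lambda>e. ((tail e, a e), (head e, b e))) ` E"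
proof (intro equalityI subsetI)
  fix p assume "p \<in> (\<Union>x\<in>lift_layer 0. pairs (lift_path a b x))"
  then obtain x j where x: "x \<in> lift_layer 0" "Suc j < L"
    "p = ((follow a b ^^ j) x, follow a b ((follow a b ^^ j) x))"
    unfolding lift_path_def pairs_map_upt by auto
  have "(follow a b ^^ j) x \<in> lift_layer j" using follow_pow_image[OF assms, of j] x by auto
  from lift_layer_tailE[OF assms(1) this x(2)] obtain e where
    "e \<in> E" "(follow a b ^^ j) x = (tail e, a e)" .
  thus "p \<in> (\<lambda>e. ((tail e, a e), (head e, b e))) ` E"
    using x(3) follow_eq[OF assms(1)] by auto
next
  fix p assume "p \<in> (\<lambda>e. ((tail e, a e), (head e, b e))) ` E"
  then obtain e where e: "e \<in> E" "p = ((tail e, a e), (head e, b e))" by blast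
  define j where "j = lay (tail e)"
  have j: "Suc j < L" using Suc_lay_tail_less[OF e(1)] unfolding j_def .
  have "(tail e, a e) \<in> (follow a b ^^ j) ` lift_layer 0"
    using tail_lift[OF assms(1) e(1)] follow_pow_image[OF assms, of j] j unfolding j_def by simp
  then obtain x where x: "x \<in> lift_layer 0" "(tail e, a e) = (follow a b ^^ j) x" by blast
  have "p = ((follow a b ^^ j) x, (follow a b ^^ Suc j) x)"
    using follow_eq[OF assms(1) e(1)] unfolding e(2) by (simp flip: x(2))
  thus "p \<in> (\<Union>x\<in>lift_layer 0. pairs (lift_path a b x))"
    unfolding lift_path_def pairs_map_upt using x(1) j by blast
qed

section \<open>Counting vertices, edges and labellings\<close>

lemma card_fibres:
  assumes "finite T" "\<And>v. v \<in> T \<Longrightarrow> card {e \<in> E. g e = v} = d"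
  shows "card {e \<in> E. g e \<in> T} = d * card T"
proof -
  have "card {e \<in> E. g e \<in> T} = (\<Sum>v\<in>T. card {e \<in> {e \<in> E. g e \<in> T}. g e = v})"
    using sum.group[of "{e \<in> E. g e \<in> T}" T g "\<lambda>_. 1 :: nat"] finite_E assms(1)
    by (auto simp: image_subset_iff)
  also have "\<dots> = (\<Sum>v\<in>T. d)"
  proof (intro sum.cong refl)
    fix v assume v: "v \<in> T"
    hence "{e \<in> {e \<in> E. g e \<in> T}. g e = v} = {e \<in> E. g e = v}" by auto
    thus "card {e \<in> {e \<in> E. g e \<in> T}. g e = v} = d" using assms(2)[OF v] by simp
  qed
  finally show ?thesis by (simp add: mult.commute)
qed

text \<open>The edges between two consecutive layers are counted from both sides.\<close>

lemma card_layer: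
  assumes "d > 0" "j < L"
  shows "card (layer j) = card (layer 0)"
  using assms(2)
proof (induction j)
  case (Suc j)
  have "d * card (layer (Suc j)) = card {e \<in> E. head e \<in> layer (Suc j)}"
    using in_degree by (intro card_fibres[symmetric] finite_layer) (auto simp: layer_def)
  also have "{e \<in> E. head e \<in> layer (Suc j)} = {e \<in> E. tail e \<in> layer j}"
    using lay_head tail_in head_in by (auto simp: layer_def)
  also have "card \<dots> = d * card (layer j)"
    using out_degree Suc.prems by (intro card_fibres finite_layer) (auto simp: layer_def)
  finally show ?case using Suc assms(1) by simp
qed simp

lemma card_lift_layer: "d > 0 \<Longrightarrow> j < L \<Longrightarrow> card (lift_layer j) = d * card (layer 0)"
  using card_layer[of j] by (simp add: lift_layer_def card_cartesian_product mult.commute)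

lemma card_layers:
  assumes "d > 0" "J \<subseteq> {..<L}"
  shows "card (\<Union>j\<in>J. layer j) = card J * card (layer 0)"
proof -
  have "card (\<Union>j\<in>J. layer j) = (\<Sum>j\<in>J. card (layer j))"
    using assms(2) finite_layer
    by (intro card_UN_disjoint) (auto simp: layer_def elim: finite_subset)
  also have "\<dots> = (\<Sum>j\<in>J. card (layer 0))"
    using assms by (intro sum.cong refl card_layer) auto
  finally show ?thesis by simp
qed

lemma card_E:
  assumes "d > 0"
  shows "card E = d * ((L - 1) * card (layer 0))"
proof -
  have "{e \<in> E. tail e \<in> (\<Union>j\<in>{..<L - 1}. layer j)} = E"
    using tail_in Suc_lay_tail_less by (fastforce simp: layer_def)
  moreover have "card {e \<in> E. tail e \<in> (\<Union>j\<in>{..<L - 1}. layer j)} = d * card (\<Union>j\<in>{..<L - 1}. layer j)"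
    using out_degree finite_layer by (intro card_fibres) (auto simp: layer_def)
  ultimately show ?thesis using card_layers[OF assms, of "{..<L - 1}"] by auto
qed

text \<open>Tails fill the layers 0 to L - 2 and each of them has d outgoing edges, giving d!
  choices per vertex.\<close>

lemma card_labellings_tail:
  assumes "d > 0"
  shows "fact d ^ ((L - 1) * card (layer 0)) \<le> card (labellings tail)"
proof -
  let ?T = "\<Union>j\<in>{..<L - 1}. layer j"
  have "fact d ^ card ?T \<le> card (labellings tail)"
    unfolding labellings_def
    using out_degree finite_layer tail_in Suc_lay_tail_less finite_E
    by (intro card_fibre_injective) (fastforce simp: layer_def)+
  thus ?thesis using card_layers[OF assms, of "{..<L - 1}"] by auto
qed

lemma card_labellings_head:
  assumes "d > 0"
  shows "fact d ^ ((L - 1) * card (layer 0)) \<le> card (labellings head)"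
proof -
  let ?T = "\<Union>j\<in>{1..<L}. layer j"
  have "fact d ^ card ?T \<le> card (labellings head)"
    unfolding labellings_def
    using in_degree finite_layer head_in Suc_lay_tail_less finite_E lay_head
    by (intro card_fibre_injective) (fastforce simp: layer_def)+
  moreover have "{1..<L} \<subseteq> {..<L}" by auto
  ultimately show ?thesis using card_layers[OF assms, of "{1..<L}"] by auto
qed

text \<open>The graph containing all Hamilton paths of the family. Each edge e of the base graph is lifted
  to a perfect matching given by the voltage c e. The vertices \<^term>\<open>Inr r\<close> form connecting paths
  of m vertices, which are too long to be used by a cycle of length m.\<close>

definition seps :: "nat \<Rightarrow> nat set" where
  "seps M = {r. m dvd r \<and> r < M * m}"

definition lift_arcs :: "('e \<Rightarrow> nat) \<Rightarrow> (('v \<times> nat) \<times> ('v \<times> nat)) set" where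
  "lift_arcs c = {((tail e, i), (head e, j)) | e i j. e \<in> E \<and> i < d \<and> j < d \<and> (i + j) mod d = c e}"

definition full_arcs :: "('e \<Rightarrow> nat) \<Rightarrow> nat \<Rightarrow> (nat \<Rightarrow> 'v \<times> nat) \<Rightarrow> (nat \<Rightarrow> 'v \<times> nat) \<Rightarrow>
    (('v \<times> nat + nat) \<times> ('v \<times> nat + nat)) set" where
  "full_arcs c M lam rho = map_prod Inl Inl ` lift_arcs c
     \<union> {(Inl (lam r), Inr r) | r. r \<in> seps M}
     \<union> {(Inr r, Inr (Suc r)) | r. Suc r \<notin> seps M}
     \<union> {(Inr r, Inl (rho r)) | r. Suc r \<in> seps M}"

text \<open>A cycle projects to a closed walk of length m in the base graph. If that walk went back
  along the edge it just used, the rule i + j = c e (mod d) would lead back to the same lifted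
  vertex, so the cycle would repeat a vertex two steps apart.\<close>

lemma no_lift_cycle:
  assumes "m \<ge> 3"
  shows "\<not> has_cycle (edges_of (lift_arcs c)) m"
proof
  assume "has_cycle (edges_of (lift_arcs c)) m"
  then obtain ws where ws: "length ws = m" "distinct ws"
    "\<And>i. i < m \<Longrightarrow> {ws ! i, ws ! ((i + 1) mod m)} \<in> edges_of (lift_arcs c)"
    unfolding has_cycle_def by blast
  define w where "w i = ws ! (i mod m)" for i
  have step: "\<exists>e\<in>E. \<exists>i<d. \<exists>j<d. {w n, w (Suc n)} = {(tail e, i), (head e, j)} \<and> (i + j) mod d = c e" for n
    using ws(3)[of "n mod m"] assms
    unfolding w_def edges_of_def lift_arcs_def by (auto simp: mod_Suc_eq)
  have "\<forall>n. \<exists>e. e \<in> E \<and> (\<exists>i<d. \<exists>j<d. {w n, w (Suc n)} = {(tail e, i), (head e, j)} \<and> (i + j) mod d = c e)"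
    using step by blast
  then obtain es' where es': "\<And>n. es' n \<in> E"
    "\<And>n. \<exists>i<d. \<exists>j<d. {w n, w (Suc n)} = {(tail (es' n), i), (head (es' n), j)} \<and> (i + j) mod d = c (es' n)"
    by metis
  define es where "es n = es' (n mod m)" for n
  have w_mod: "w (n mod m) = w n" "w (Suc (n mod m)) = w (Suc n)" for n
    unfolding w_def by (simp_all add: mod_Suc_eq)
  have es: "\<exists>i<d. \<exists>j<d. {w n, w (Suc n)} = {(tail (es n), i), (head (es n), j)} \<and> (i + j) mod d = c (es n)" for n
    using es'(2)[of "n mod m"] unfolding es_def w_mod .
  have E: "es n \<in> E" for n unfolding es_def by (rule es'(1))
  show False
  proof (rule no_closed_walk[of es "\<lambda>n. fst (w n)"])
    show "es n \<in> E" for n by (rule E)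
    show "{fst (w n), fst (w (Suc n))} = {tail (es n), head (es n)}" for n
    proof -
      obtain i j where "{w n, w (Suc n)} = {(tail (es n), i), (head (es n), j)}" using es by blast
      hence "fst ` {w n, w (Suc n)} = fst ` {(tail (es n), i), (head (es n), j)}" by (rule arg_cong)
      thus ?thesis by simp
    qed
    show "es (n + m) = es n" "fst (w (n + m)) = fst (w n)" for n unfolding es_def w_def by simp_all
    show "es (Suc n) \<noteq> es n" for n
    proof
      assume eq: "es (Suc n) = es n"
      define e where "e = es n"
      obtain i j where ij: "i < d" "j < d" "{w n, w (Suc n)} = {(tail e, i), (head e, j)}"
        "(i + j) mod d = c e" using es[of n] unfolding e_def by blast
      obtain i' j' where ij': "i' < d" "j' < d"
        "{w (Suc n), w (Suc (Suc n))} = {(tail e, i'), (head e, j')}"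
        "(i' + j') mod d = c e" using es[of "Suc n"] unfolding eq e_def by blast
      have ne: "tail e \<noteq> head e" using lay_head[OF E[of n]] unfolding e_def by auto
      have "w (Suc (Suc n)) = w n"
      proof (cases "w (Suc n) = (tail e, i)")
        case True
        hence "w n = (head e, j)" "i = i'" "w (Suc (Suc n)) = (head e, j')"
          using ij(3) ij'(3) ne by (auto simp: doubleton_eq_iff)
        moreover have "j = j'" using \<open>i = i'\<close> ij(2,4) ij'(2,4) by (intro add_mod_left_cancel[of i j d j']) auto
        ultimately show ?thesis by simp
      next
        case False
        hence "w (Suc n) = (head e, j)" using ij(3) by (auto simp: doubleton_eq_iff)
        hence "w n = (tail e, i)" "j = j'" "w (Suc (Suc n)) = (tail e, i')"
          using ij(3) ij'(3) ne by (auto simp: doubleton_eq_iff)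
        moreover have "i = i'" using \<open>j = j'\<close> ij(1,4) ij'(1,4) by (intro add_mod_left_cancel[of j i d i']) (auto simp: add.commute)
        ultimately show ?thesis by simp
      qed
      hence "Suc (Suc n) mod m = n mod m"
        using ws(1,2) assms unfolding w_def by (simp add: nth_eq_iff_index_eq)
      hence "m dvd 2" using mod_eq_dvd_iff_nat[of n "Suc (Suc n)" m] by simp
      thus False using assms by (auto dest: dvd_imp_le)
    qed
  qed
qed

text \<open>Connecting vertices have only two neighbours, so a cycle through one of them contains a
  whole run of m connecting vertices together with the path end before it, which is m + 1 vertices.
  Any other cycle lies in the lift.\<close>

lemma no_full_cycle:
  assumes m: "m \<ge> 3" and M: "M > 0"
  shows "\<not> has_cycle (edges_of (full_arcs c M lam rho)) m"
proof
  let ?G = "edges_of (full_arcs c M lam rho)"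
  assume "has_cycle ?G m"
  then obtain vs where vs: "length vs = m" "distinct vs"
    "\<And>i. i < m \<Longrightarrow> {vs ! i, vs ! ((i + 1) mod m)} \<in> ?G"
    unfolding has_cycle_def by blast
  define prv where "prv r = (if r \<in> seps M then Inl (lam r) else Inr (r - 1))" for r
  define nxt where "nxt r = (if Suc r \<in> seps M then Inl (rho r) else Inr (Suc r))" for r
  have nb: "y = prv r \<or> y = nxt r" if "{Inr r, y} \<in> ?G" for r y
    using that unfolding edges_of_def full_arcs_def prv_def nxt_def
    by (auto simp: doubleton_eq_iff)
  have both: "prv r \<in> set vs" "nxt r \<in> set vs" if "Inr r \<in> set vs" for r
    using cycle_neighbours[OF vs m that nb] by auto
  \<comment> \<open>Going backwards along a connecting path, including the unbounded last one,
    reaches the first vertex of a run; 0 is such a vertex because M > 0.\<close>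
  have start: "\<exists>s\<in>seps M. Inr s \<in> set vs" if "Inr r \<in> set vs" for r
    using that
  proof (induction r rule: less_induct)
    case (less r)
    show ?case
    proof (cases "r \<in> seps M")
      case False
      hence "r \<noteq> 0" using m M by (cases r) (auto simp: seps_def)
      moreover have "Inr (r - 1) \<in> set vs" using both(1)[OF less.prems] False by (simp add: prv_def)
      ultimately show ?thesis using less.IH[of "r - 1"] by auto
    qed (use less in auto)
  qed
  have no_Inr: "Inr r \<notin> set vs" for r
  proof
    assume "Inr r \<in> set vs"
    then obtain s where s: "s \<in> seps M" "Inr s \<in> set vs" using start by blast
    have run: "j < m \<Longrightarrow> Inr (s + j) \<in> set vs" for j
    proof (induction j)
      case (Suc j)
      have "\<not> m dvd Suc j" using Suc.prems by (auto dest: dvd_imp_le)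
      moreover have "m dvd s" using s(1) by (simp add: seps_def)
      ultimately have "\<not> m dvd s + Suc j" using dvd_add_right_iff by blast
      hence "Suc (s + j) \<notin> seps M" by (simp add: seps_def)
      thus ?case using both(2)[OF Suc.IH] Suc.prems by (simp add: nxt_def)
    qed (use s in simp)
    have "Inl (lam s) \<in> set vs" using both(1)[OF s(2)] s(1) by (simp add: prv_def)
    hence sub: "insert (Inl (lam s)) ((\<lambda>j. Inr (s + j)) ` {..<m}) \<subseteq> set vs" using run by auto
    have "card (insert (Inl (lam s) :: 'v \<times> nat + nat) ((\<lambda>j. Inr (s + j)) ` {..<m})) = Suc m"
      by (subst card_insert_disjoint) (auto simp: card_image inj_on_def)
    moreover have "card (set vs) = m" using vs(1,2) by (simp add: distinct_card)
    ultimately show False using card_mono[OF _ sub] by simp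
  qed
  define ws where "ws = map projl vs"
  have Inl: "vs ! i = Inl (ws ! i)" if "i < m" for i
    using no_Inr nth_mem[of i vs] vs(1) that unfolding ws_def by (cases "vs ! i") auto
  have "distinct ws"
    using vs(2) no_Inr unfolding ws_def
    by (auto simp: distinct_map intro!: inj_onI) (metis sum.collapse(1) sum.collapse(2))
  moreover have "{ws ! i, ws ! ((i + 1) mod m)} \<in> edges_of (lift_arcs c)" if i: "i < m" for i
  proof -
    have "(i + 1) mod m < m" using m by simp
    hence "{Inl (ws ! i), Inl (ws ! ((i + 1) mod m))} \<in> ?G"
      using vs(3)[OF i] Inl[OF i] Inl[of "(i + 1) mod m"] by simp
    thus ?thesis unfolding edges_of_def full_arcs_def by (fastforce simp: doubleton_eq_iff)
  qed
  ultimately have "has_cycle (edges_of (lift_arcs c)) m"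
    unfolding has_cycle_def using vs(1) unfolding ws_def by (intro exI[of _ "map projl vs"]) auto
  thus False using no_lift_cycle[OF m] by blast
qed

end

subsection \<open>A cycle-free family of Hamilton paths\<close>

lemma edges_ofI: "(x, y) \<in> R \<Longrightarrow> {x, y} \<in> edges_of R"
  unfolding edges_of_def by blast

lemma edges_of_mono: "R \<subseteq> R' \<Longrightarrow> edges_of R \<subseteq> edges_of R'"
  unfolding edges_of_def by blast

lemma edges_of_map_prod: "edges_of (map_prod f f ` R) = (`) f ` edges_of R"
proof -
  have image: "edges_of S = (\<lambda>p. {fst p, snd p}) ` S" for S :: "('c \<times> 'c) set"
    unfolding edges_of_def by force
  show ?thesis unfolding image image_image by simp
qed

lemma UN_set_conv_nth: "(\<Union>x\<in>set xs. f x) = (\<Union>i<length xs. f (xs ! i))"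
  unfolding set_conv_nth by blast

lemma pairs_in_set: "(x, y) \<in> pairs p \<Longrightarrow> x \<in> set p \<and> y \<in> set p"
  unfolding pairs_conv_nth by auto

lemma contains_cycle_conv_has_cycle: "contains_cycle = has_cycle"
  by (simp add: fun_eq_iff contains_cycle_def has_cycle_def)

context layered_graph
begin

definition path_end :: "('e \<Rightarrow> nat) \<Rightarrow> ('e \<Rightarrow> nat) \<Rightarrow> 'v \<times> nat \<Rightarrow> 'v \<times> nat" where
  "path_end a b x = (follow a b ^^ (L - 1)) x"

text \<open>One lifted path followed by its own run of m connecting vertices.\<close>

definition block :: "('e \<Rightarrow> nat) \<Rightarrow> ('e \<Rightarrow> nat) \<Rightarrow> ('v \<times> nat) list \<Rightarrow> nat \<Rightarrow> ('v \<times> nat + nat) list" where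
  "block a b xs i = map Inl (lift_path a b (xs ! i)) @ map Inr [i * m..<i * m + m]"

text \<open>The blocks in the fixed order of \<open>xs\<close>, then the remaining connecting
  vertices below R, which bring the number of vertices up to n.\<close>

definition ham_list :: "('e \<Rightarrow> nat) \<Rightarrow> ('e \<Rightarrow> nat) \<Rightarrow> ('v \<times> nat) list \<Rightarrow> nat \<Rightarrow> ('v \<times> nat + nat) list" where
  "ham_list a b xs R = concat (map (block a b xs) [0..<length xs]) @ map Inr [length xs * m..<R]"

lemma lift_path_simps:
  assumes "L > 0"
  shows "lift_path a b x \<noteq> []" "hd (lift_path a b x) = x" "last (lift_path a b x) = path_end a b x"
  using assms by (simp_all add: lift_path_def path_end_def hd_map last_map)

lemma length_block: "length (block a b xs i) = L + m"
  by (simp add: block_def lift_path_def)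

lemma length_ham_list:
  assumes "length xs * m \<le> R"
  shows "length (ham_list a b xs R) = length xs * L + R"
proof -
  have "length (concat (map (block a b xs) [0..<M])) = M * (L + m)" for M
    by (induction M) (simp_all add: length_block)
  thus ?thesis using assms unfolding ham_list_def by (simp add: algebra_simps)
qed

lemma set_ham_list:
  assumes "a \<in> labellings tail" "b \<in> labellings head" "set xs = lift_layer 0" "length xs * m \<le> R"
  shows "set (ham_list a b xs R) = Inl ` (\<Union>j<L. lift_layer j) \<union> Inr ` {..<R}"
proof -
  have runs: "(\<Union>i<M. {i * m..<i * m + m}) = {..<M * m}" for M
    by (induction M) (auto simp: lessThan_Suc)
  have "(\<Union>i<length xs. set (lift_path a b (xs ! i))) = (\<Union>x\<in>lift_layer 0. set (lift_path a b x))"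
    unfolding assms(3)[symmetric] by (rule UN_set_conv_nth[symmetric])
  also have "\<dots> = (\<Union>j<L. (follow a b ^^ j) ` lift_layer 0)"
    unfolding lift_path_def by auto
  also have "\<dots> = (\<Union>j<L. lift_layer j)"
    using follow_pow_image[OF assms(1,2)] by simp
  finally have paths: "(\<Union>i<length xs. set (lift_path a b (xs ! i))) = (\<Union>j<L. lift_layer j)" .
  have "set (concat (map (block a b xs) [0..<length xs])) =
      Inl ` (\<Union>i<length xs. set (lift_path a b (xs ! i))) \<union> Inr ` (\<Union>i<length xs. {i * m..<i * m + m})"
    unfolding block_def by (simp add: image_UN UN_Un_distrib atLeast0LessThan)
  also have "\<dots> = Inl ` (\<Union>j<L. lift_layer j) \<union> Inr ` {..<length xs * m}"
    unfolding paths runs ..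
  finally have "set (ham_list a b xs R) = Inl ` (\<Union>j<L. lift_layer j) \<union> Inr ` ({..<length xs * m} \<union> {length xs * m..<R})"
    unfolding ham_list_def by auto
  also have "{..<length xs * m} \<union> {length xs * m..<R} = {..<R}" using assms(4) by auto
  finally show ?thesis .
qed

definition label_arcs :: "('e \<Rightarrow> nat) \<Rightarrow> ('e \<Rightarrow> nat) \<Rightarrow> (('v \<times> nat) \<times> ('v \<times> nat)) set" where
  "label_arcs a b = (\<lambda>e. ((tail e, a e), (head e, b e))) ` E"

lemma pairs_block:
  assumes "L > 0" "m > 0"
  shows "pairs (block a b xs i) = map_prod Inl Inl ` pairs (lift_path a b (xs ! i)) \<union>
    {(Inr r, Inr (Suc r)) | r. i * m \<le> r \<and> Suc r < i * m + m} \<union> {(Inl (path_end a b (xs ! i)), Inr (i * m))}"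
proof -
  define ys :: "('v \<times> nat + nat) list" where "ys = map Inr [i * m..<i * m + m]"
  have "ys \<noteq> []" "hd ys = Inr (i * m)"
    using assms(2) unfolding ys_def by (simp_all add: hd_map)
  moreover have "pairs ys = {(Inr r, Inr (Suc r)) | r. i * m \<le> r \<and> Suc r < i * m + m}"
    unfolding ys_def by (rule pairs_map_upt)
  ultimately show ?thesis unfolding block_def pairs_append ys_def[symmetric]
    using lift_path_simps[OF assms(1)] by (simp add: pairs_map last_map)
qed

lemma ends_block:
  assumes "L > 0" "m > 0"
  shows "block a b xs i \<noteq> []" "hd (block a b xs i) = Inl (xs ! i)" "last (block a b xs i) = Inr (i * m + m - 1)"
  using assms lift_path_simps[OF assms(1)] unfolding block_def by (simp_all add: hd_append hd_map last_map)

text \<open>Every labelled arc occurs in the Hamilton path, which is why the path determines both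
  labellings.\<close>

lemma label_arcs_subset_pairs:
  assumes "a \<in> labellings tail" "b \<in> labellings head" "set xs = lift_layer 0" "L > 0" "m > 0"
  shows "map_prod Inl Inl ` label_arcs a b \<subseteq> pairs (ham_list a b xs R)"
proof -
  have "label_arcs a b = (\<Union>x\<in>set xs. pairs (lift_path a b x))"
    unfolding label_arcs_def assms(3) pairs_lift_paths[OF assms(1,2)] ..
  also have "\<dots> = (\<Union>i<length xs. pairs (lift_path a b (xs ! i)))"
    by (rule UN_set_conv_nth)
  finally have "label_arcs a b = (\<Union>i<length xs. pairs (lift_path a b (xs ! i)))" .
  hence "map_prod Inl Inl ` label_arcs a b = (\<Union>i<length xs. map_prod Inl Inl ` pairs (lift_path a b (xs ! i)))"
    by (simp only: image_UN)
  also have "\<dots> \<subseteq> (\<Union>i<length xs. pairs (block a b xs i))"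
    unfolding pairs_block[OF assms(4,5)] by (intro UN_mono order_refl le_supI1)
  also have "\<dots> \<subseteq> pairs (concat (map (block a b xs) [0..<length xs]))"
    unfolding pairs_concat[of "block a b xs", OF ends_block(1)[OF assms(4,5)]] by (rule Un_upper1)
  also have "\<dots> \<subseteq> pairs (ham_list a b xs R)"
    unfolding ham_list_def pairs_append by (intro le_supI1 order_refl)
  finally show ?thesis .
qed

text \<open>Apart from the labelled arcs, the path depends on \<open>a\<close> and \<open>b\<close>
  only through the ends of the lifted paths. Once these ends are fixed, all connecting arcs are
  common to the family.\<close>

lemma pairs_ham_list_subset:
  assumes "a \<in> labellings tail" "b \<in> labellings head" "set xs = lift_layer 0" "L > 0" "m > 0"
    and M: "length xs = M"
  shows "pairs (ham_list a b xs R) \<subseteq> map_prod Inl Inl ` label_arcs a b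
     \<union> {(Inl (path_end a b (xs ! (r div m))), Inr r) | r. r \<in> seps M}
     \<union> {(Inr r, Inr (Suc r)) | r. Suc r \<notin> seps M}
     \<union> {(Inr r, Inl (xs ! (Suc r div m))) | r. Suc r \<in> seps M}" (is "_ \<subseteq> ?S")
proof -
  note ends = ends_block[OF assms(4,5)]
  have seps: "i * m \<in> seps M" if "i < M" for i using that assms(5) by (simp add: seps_def)
  have arcs: "pairs (lift_path a b (xs ! i)) \<subseteq> label_arcs a b" if "i < M" for i
  proof -
    have "xs ! i \<in> lift_layer 0" using that M assms(3) nth_mem by blast
    thus ?thesis using pairs_lift_paths[OF assms(1,2)] unfolding label_arcs_def by blast
  qed
  have 1: "pairs (block a b xs i) \<subseteq> ?S" if i: "i < M" for i
  proof -
    have "Suc r \<notin> seps M" if r: "i * m \<le> r" "Suc r < i * m + m" for r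
    proof
      assume "Suc r \<in> seps M"
      then obtain q where q: "Suc r = q * m" by (auto simp: seps_def mult.commute)
      have "i * m < q * m" using r q by linarith
      moreover have "q * m < (i + 1) * m" using r q by simp
      ultimately have "i < q" "q < i + 1" unfolding mult_less_cancel2 by simp_all
      thus False by simp
    qed
    hence "{(Inr r, Inr (Suc r)) | r. i * m \<le> r \<and> Suc r < i * m + m} \<subseteq> ?S" by blast
    moreover have "(Inl (path_end a b (xs ! i)), Inr (i * m)) \<in> ?S"
      using seps[OF i] assms(5) by (intro UnI1 UnI2 CollectI exI[of _ "i * m"]) auto
    moreover have "map_prod Inl Inl ` pairs (lift_path a b (xs ! i)) \<subseteq> ?S"
      using arcs[OF i] by blast
    ultimately show ?thesis unfolding pairs_block[OF assms(4,5)] by blast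
  qed
  have 2: "(last (block a b xs i), hd (block a b xs (Suc i))) \<in> ?S" if i: "Suc i < M" for i
  proof -
    define r where "r = i * m + m - 1"
    have r: "Suc r = Suc i * m" using assms(5) unfolding r_def by simp
    have "Suc r div m = Suc i" unfolding r using assms(5) by (metis nonzero_mult_div_cancel_right not_gr0)
    hence "(last (block a b xs i), hd (block a b xs (Suc i))) = (Inr r, Inl (xs ! (Suc r div m)))"
      unfolding ends r_def[symmetric] by simp
    moreover have "Suc r \<in> seps M" unfolding r by (rule seps[OF i])
    ultimately show ?thesis by blast
  qed
  have big: "Suc r \<notin> seps M" if "M * m \<le> Suc r" for r using that by (simp add: seps_def)
  have 3: "pairs (map Inr [M * m..<R]) \<subseteq> ?S"
    unfolding pairs_map_upt using big by fastforce
  have 4: "(last (concat (map (block a b xs) [0..<M])), hd (map Inr [M * m..<R])) \<in> ?S"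
    if ne: "concat (map (block a b xs) [0..<M]) \<noteq> []" "map Inr [M * m..<R] \<noteq> ([] :: ('v \<times> nat + nat) list)"
  proof -
    obtain M' where M': "M = Suc M'" using ne(1) by (cases M) auto
    have "last (concat (map (block a b xs) [0..<M])) = Inr (M * m - 1)"
      unfolding M' using ends by (simp add: add.commute)
    moreover have "hd (map Inr [M * m..<R]) = Inr (Suc (M * m - 1))"
      using ne(2) M' assms(5) by (simp add: hd_map)
    ultimately show ?thesis using big[of "M * m - 1"] by auto
  qed
  show ?thesis
  proof -
    define T where "T = ?S"
    note facts = 1[folded T_def] 2[folded T_def] 3[folded T_def] 4[folded T_def]
    show ?thesis
      unfolding T_def[symmetric] ham_list_def M pairs_append pairs_concat[of "block a b xs", OF ends(1)]
    proof (intro Un_least UN_least)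
      show "{(last (block a b xs i), hd (block a b xs (Suc i))) | i. Suc i < M} \<subseteq> T"
        using facts(2) by blast
      show "(if concat (map (block a b xs) [0..<M]) \<noteq> [] \<and> map Inr [M * m..<R] \<noteq> []
          then {(last (concat (map (block a b xs) [0..<M])), hd (map Inr [M * m..<R]))} else {}) \<subseteq> T"
        using facts(4) by simp
    qed (use facts in auto)
  qed
qed

text \<open>The pigeonhole principle fixes the voltages and the ends of the lifted paths for many
  pairs of labellings. All their Hamilton paths lie in one graph \<open>full_arcs\<close>, and
  distinct pairs give distinct paths.\<close>

lemma cycle_free_ham_paths:
  assumes m: "m \<ge> 3" and L: "L > 0" and d: "d > 0" and V0: "card (layer 0) > 0"
    and n: "d * card (layer 0) * (L + m) \<le> n"
  shows "\<exists>I\<subseteq>ham_paths n. finite I \<and> (\<forall>P\<in>I. \<forall>Q\<in>I. \<not> contains_cycle (P \<union> Q) m) \<and>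
    fact d ^ (2 * ((L - 1) * card (layer 0))) \<le>
      d ^ (d * ((L - 1) * card (layer 0))) * (d * card (layer 0)) ^ (d * card (layer 0)) * card I"
proof -
  define M where "M = d * card (layer 0)"
  define R where "R = n - M * L"
  have M0: "M > 0" unfolding M_def using d V0 by simp
  have nR: "n = M * L + R" "M * m \<le> R"
    using n unfolding R_def M_def by (simp_all add: algebra_simps)
  have cardW: "card (lift_layer j) = M" if "j < L" for j
    using card_lift_layer[OF d that] unfolding M_def .
  obtain xs where xs: "set xs = lift_layer 0" "distinct xs"
    using finite_distinct_list[OF finite_lift_layer] by blast
  have len: "length xs = M" using distinct_card[OF xs(2)] xs(1) cardW[OF L] by simp
  have m0: "m > 0" using m by simp
  define \<Omega> where "\<Omega> = (Inl ` (\<Union>j<L. lift_layer j) \<union> Inr ` {..<R} :: ('v \<times> nat + nat) set)"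
  have "card (\<Union>j<L. lift_layer j) = (\<Sum>j<L. card (lift_layer j))"
    using finite_lift_layer by (intro card_UN_disjoint) (auto simp: lift_layer_def layer_def)
  also have "\<dots> = L * M" using cardW by simp
  finally have "card \<Omega> = n" unfolding \<Omega>_def nR(1) using finite_lift_layer
    by (subst card_Un_disjoint) (auto simp: card_image mult.commute)
  moreover have fin\<Omega>: "finite \<Omega>" unfolding \<Omega>_def using finite_lift_layer by auto
  ultimately obtain \<iota> where \<iota>: "bij_betw \<iota> \<Omega> {0..<n}"
    using ex_bij_betw_finite_nat by metis
  have inj: "inj_on \<iota> \<Omega>" and img: "\<iota> ` \<Omega> = {0..<n}" using \<iota> by (auto simp: bij_betw_def)
  define hl where "hl = (\<lambda>(a, b). ham_list a b xs R)"
  define P where "P ab = path_edges (map \<iota> (hl ab))" for ab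
  let ?X = "labellings tail \<times> labellings head"
  have set_hl: "set (hl ab) = \<Omega>" if "ab \<in> ?X" for ab
  proof -
    obtain a b where ab: "ab = (a, b)" by (cases ab)
    show ?thesis unfolding ab hl_def \<Omega>_def prod.case
      using that nR(2) len xs(1) unfolding ab by (intro set_ham_list) auto
  qed
  have P_ham: "P ab \<in> ham_paths n" if ab: "ab \<in> ?X" for ab
  proof -
    have "length (hl ab) = n"
      using ab length_ham_list nR unfolding hl_def len[symmetric] by auto
    \<comment> \<open>The list has n entries and covers the n elements of \<open>\<Omega>\<close>,
      so no entry repeats.\<close>
    hence "distinct (hl ab)"
      using \<open>card \<Omega> = n\<close> set_hl[OF ab] by (intro card_distinct) simp
    hence "distinct (map \<iota> (hl ab))" "set (map \<iota> (hl ab)) = {0..<n}"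
      using inj img set_hl[OF ab] by (simp_all add: distinct_map)
    thus ?thesis unfolding ham_paths_def P_def by blast
  qed
  have P_eq: "P ab = (`) \<iota> ` edges_of (pairs (hl ab))" for ab
    unfolding P_def path_edges_conv_pairs pairs_map edges_of_map_prod ..
  have sub\<Omega>: "e \<subseteq> \<Omega>" if "ab \<in> ?X" "e \<in> edges_of (pairs (hl ab))" for ab e
    using that(2) set_hl[OF that(1)] pairs_in_set unfolding edges_of_def by fastforce
  \<comment> \<open>The data shared by a family: the voltage of each edge, and the end of each
    lifted path as a function of its start.\<close>
  define f where "f = (\<lambda>(a, b). (\<lambda>e\<in>E. (a e + b e) mod d, \<lambda>x\<in>lift_layer 0. path_end a b x))"
  define Y0 where "Y0 = (E \<rightarrow>\<^sub>E {..<d}) \<times> (lift_layer 0 \<rightarrow>\<^sub>E lift_layer (L - 1))"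
  have "path_end a b x \<in> lift_layer (L - 1)"
    if "a \<in> labellings tail" "b \<in> labellings head" "x \<in> lift_layer 0" for a b x
    using follow_pow_image[OF that(1,2), of "L - 1"] that(3) L unfolding path_end_def by auto
  hence fX: "f ` ?X \<subseteq> Y0" unfolding f_def Y0_def using d by auto
  have finY: "finite Y0" unfolding Y0_def
    using finite_E finite_lift_layer by (intro finite_cartesian_product finite_PiE) auto
  have cardY: "card Y0 = d ^ (d * ((L - 1) * card (layer 0))) * M ^ M"
    unfolding Y0_def card_cartesian_product
    using card_funcsetE[OF finite_E, of "{..<d}"] card_funcsetE[OF finite_lift_layer, of 0 "lift_layer (L - 1)"]
      cardW[of 0] cardW[of "L - 1"] L card_E[OF d] by simp
  have finlab: "finite (labellings g)" for g
    unfolding labellings_def using finite_PiE[OF finite_E, of "\<lambda>_. {..<d}"] by (rule rev_finite_subset) auto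
  have "fact d ^ ((L - 1) * card (layer 0)) * fact d ^ ((L - 1) * card (layer 0)) \<le> card ?X"
    unfolding card_cartesian_product
    using card_labellings_tail[OF d] card_labellings_head[OF d] by (intro mult_mono) auto
  hence cardX: "fact d ^ (2 * ((L - 1) * card (layer 0))) \<le> card ?X"
    by (simp add: power_add[symmetric] mult_2)
  have "?X \<noteq> {}"
  proof
    assume "?X = {}"
    with cardX show False by simp
  qed
  hence "Y0 \<noteq> {}" using fX by blast
  obtain y where y: "y \<in> Y0" "card ?X \<le> card Y0 * card {ab \<in> ?X. f ab = y}"
    using pigeonhole_fibre[OF _ finY \<open>Y0 \<noteq> {}\<close> fX] finlab by blast
  obtain c \<tau> where c\<tau>: "y = (c, \<tau>)" by (cases y)
  define Z where "Z = {ab \<in> ?X. f ab = y}"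
  have finZ: "finite Z" unfolding Z_def using finlab by simp
  have "inj_on P Z"
  proof (rule inj_onI)
    fix ab ab' assume Z: "ab \<in> Z" "ab' \<in> Z" and eq: "P ab = P ab'"
    obtain a b where ab: "ab = (a, b)" by (cases ab)
    obtain a' b' where ab': "ab' = (a', b')" by (cases ab')
    have X: "(a, b) \<in> ?X" "(a', b') \<in> ?X" using Z unfolding Z_def ab ab' by auto
    have lab: "a \<in> labellings tail" "b \<in> labellings head" "a' \<in> labellings tail" "b' \<in> labellings head"
      using X by auto
    have "inj_on ((`) \<iota>) (Pow \<Omega>)" using inj by (rule inj_on_image_Pow)
    moreover have "edges_of (pairs (hl ab)) \<subseteq> Pow \<Omega>" "edges_of (pairs (hl ab')) \<subseteq> Pow \<Omega>"
      using sub\<Omega> X unfolding ab ab' by blast+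
    ultimately have edges: "edges_of (pairs (hl ab)) = edges_of (pairs (hl ab'))"
      using eq unfolding P_eq by (simp add: inj_on_image_eq_iff)
    have same: "a e = a' e \<and> b e = b' e" if e: "e \<in> E" for e
    proof -
      have "(Inl (tail e, a e), Inl (head e, b e)) \<in> pairs (hl ab)"
        using label_arcs_subset_pairs[OF lab(1,2) xs(1) L m0, of R] e
        unfolding hl_def ab label_arcs_def by auto
      hence "{Inl (tail e, a e), Inl (head e, b e)} \<in> edges_of (pairs (hl ab'))"
        unfolding edges[symmetric] by (rule edges_ofI)
      then obtain p q where pq: "{Inl (tail e, a e), Inl (head e, b e)} = {p, q}" "(p, q) \<in> pairs (hl ab')"
        unfolding edges_of_def by blast
      hence "p \<in> range Inl" "q \<in> range Inl" by (auto simp: doubleton_eq_iff)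
      hence "(p, q) \<in> map_prod Inl Inl ` label_arcs a' b'"
        using pq(2) pairs_ham_list_subset[OF lab(3,4) xs(1) L m0 len, of R]
        unfolding hl_def ab' by auto
      then obtain e' where e': "e' \<in> E" "p = Inl (tail e', a' e')" "q = Inl (head e', b' e')"
        unfolding label_arcs_def by auto
      \<comment> \<open>The ends of an edge lie in different layers, so the undirected edge still
        tells its tail from its head.\<close>
      have "(tail e, a e) = (tail e', a' e') \<and> (head e, b e) = (head e', b' e')"
        using pq(1) lay_head[OF e] lay_head[OF e'(1)] unfolding e' by (auto simp: doubleton_eq_iff)
      moreover from this have "e = e'" using edge_eqI[OF e e'(1)] by simp
      ultimately show ?thesis by simp
    qed
    have "a = a'" "b = b'"
      using lab same unfolding labellings_def by (auto intro!: PiE_ext[of _ E "\<lambda>_. {..<d}"])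
    thus "ab = ab'" unfolding ab ab' by simp
  qed
  hence card_I: "card (P ` Z) = card Z" by (rule card_image)
  \<comment> \<open>The run starting at r is entered from \<open>lam r\<close>, the end of the
    preceding lifted path; the run ending at r leads to \<open>rho r\<close>, the start of the next
    one.\<close>
  define lam where "lam r = \<tau> (xs ! (r div m))" for r
  define rho where "rho r = xs ! (Suc r div m)" for r
  \<comment> \<open>\<open>full_arcs\<close> has infinitely many connecting vertices, whereas
    \<open>\<iota>\<close> is injective only on \<open>\<Omega>\<close>.\<close>
  define G where "G = {e \<in> edges_of (full_arcs c M lam rho). e \<subseteq> \<Omega>}"
  have P_sub: "P ab \<subseteq> (`) \<iota> ` G" if Z: "ab \<in> Z" for ab
  proof -
    obtain a b where ab: "ab = (a, b)" by (cases ab)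
    have X: "(a, b) \<in> ?X" and fy: "f (a, b) = (c, \<tau>)" using Z unfolding Z_def ab c\<tau> by auto
    have lab: "a \<in> labellings tail" "b \<in> labellings head" using X by auto
    have ce: "c e = (a e + b e) mod d" if "e \<in> E" for e
      using fun_cong[of _ _ e, OF arg_cong[OF fy, of fst]] that unfolding f_def by simp
    have te: "\<tau> x = path_end a b x" if "x \<in> lift_layer 0" for x
      using fun_cong[of _ _ x, OF arg_cong[OF fy, of snd]] that unfolding f_def by simp
    have lam: "lam r = path_end a b (xs ! (r div m))" if "r \<in> seps M" for r
    proof -
      have "r div m < M" using that by (simp add: seps_def less_mult_imp_div_less)
      hence "xs ! (r div m) \<in> lift_layer 0" using len xs(1) by (metis nth_mem)
      thus ?thesis unfolding lam_def by (rule te)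
    qed
    have "((tail e, a e), (head e, b e)) \<in> lift_arcs c" if "e \<in> E" for e
      unfolding lift_arcs_def
      using that ce[OF that] labelling_less[OF lab(1) that] labelling_less[OF lab(2) that]
      by (intro CollectI exI[of _ e] exI[of _ "a e"] exI[of _ "b e"]) auto
    hence "label_arcs a b \<subseteq> lift_arcs c" unfolding label_arcs_def by blast
    moreover have "{(Inl (path_end a b (xs ! (r div m))), Inr r) | r. r \<in> seps M} \<subseteq>
        {(Inl (lam r), Inr r) | r. r \<in> seps M}" using lam by auto
    ultimately have "pairs (ham_list a b xs R) \<subseteq> full_arcs c M lam rho"
      unfolding full_arcs_def rho_def
      by (intro order_trans[OF pairs_ham_list_subset[OF lab xs(1) L m0 len, of R]]
          Un_mono image_mono order_refl)
    hence "pairs (hl ab) \<subseteq> full_arcs c M lam rho" by (simp add: hl_def ab)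
    hence "edges_of (pairs (hl ab)) \<subseteq> G"
      using sub\<Omega>[of ab] edges_of_mono X unfolding G_def ab by blast
    thus ?thesis unfolding P_eq by blast
  qed
  have "\<not> contains_cycle (P1 \<union> P2) m" if P12: "P1 \<in> P ` Z" "P2 \<in> P ` Z" for P1 P2
  proof
    assume "contains_cycle (P1 \<union> P2) m"
    hence "has_cycle ((`) \<iota> ` G) m"
      using P12 P_sub unfolding contains_cycle_conv_has_cycle by (elim has_cycle_mono) blast
    hence "has_cycle G m"
      by (rule has_cycle_image[OF _ inj]) (auto simp: G_def m0)
    hence "has_cycle (edges_of (full_arcs c M lam rho)) m"
      by (rule has_cycle_mono) (auto simp: G_def)
    thus False using no_full_cycle[OF m M0] by blast
  qed
  moreover have "P ` Z \<subseteq> ham_paths n" using P_ham unfolding Z_def by blast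
  moreover have "fact d ^ (2 * ((L - 1) * card (layer 0))) \<le>
      d ^ (d * ((L - 1) * card (layer 0))) * M ^ M * card (P ` Z)"
    using cardX y(2) unfolding card_I cardY Z_def[symmetric] by linarith
  ultimately show ?thesis using finZ unfolding M_def by (intro exI[of _ "P ` Z"]) auto
qed

end

subsection \<open>Comparison with cycle-creating families\<close>

lemma finite_ham_paths: "finite (ham_paths n)"
proof (rule finite_subset)
  have "path_edges p \<subseteq> Pow (set p)" for p
    unfolding path_edges_def by (auto intro!: nth_mem)
  thus "ham_paths n \<subseteq> Pow (Pow {0..<n})"
    unfolding ham_paths_def by blast
qed simp

lemma H_cycle_attained:
  "\<exists>F\<subseteq>ham_paths n. (\<forall>P\<in>F. \<forall>Q\<in>F. P \<noteq> Q \<longrightarrow> contains_cycle (P \<union> Q) m) \<and> H_cycle m n = card F"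
proof -
  let ?S = "{card F | F. F \<subseteq> ham_paths n \<and> (\<forall>P\<in>F. \<forall>Q\<in>F. P \<noteq> Q \<longrightarrow> contains_cycle (P \<union> Q) m)}"
  have "?S \<subseteq> card ` Pow (ham_paths n)" by auto
  hence "finite ?S" by (rule finite_subset) (simp add: finite_ham_paths)
  moreover have "card {} \<in> ?S" by (intro CollectI exI[of _ "{}"]) simp
  hence "?S \<noteq> {}" by (metis empty_iff)
  ultimately have "Max ?S \<in> ?S" by (rule Max_in)
  thus ?thesis unfolding H_cycle_def by blast
qed

lemma ham_paths_transitive:
  assumes "P \<in> ham_paths n" "Q \<in> ham_paths n"
  shows "\<exists>\<pi>. \<pi> permutes {0..<n} \<and> P = (`) \<pi> ` Q"
proof -
  obtain p q where p: "P = path_edges p" "distinct p" "set p = {0..<n}"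
    and q: "Q = path_edges q" "distinct q" "set q = {0..<n}"
    using assms unfolding ham_paths_def by blast
  have len: "length p = length q" using p q distinct_card by metis
  define \<pi> where "\<pi> x = (if x \<in> {0..<n} then the (map_of (zip q p) x) else x)" for x
  have map: "map \<pi> q = p"
    using len q by (intro nth_equalityI) (auto simp: \<pi>_def map_of_zip_nth simp flip: q(3))
  hence "\<pi> ` {0..<n} = {0..<n}" using p(3) q(3) by (metis list.set_map)
  hence "bij_betw \<pi> {0..<n} {0..<n}" by (simp add: bij_betw_def eq_card_imp_inj_on)
  hence "\<pi> permutes {0..<n}" by (rule bij_imp_permutes) (simp add: \<pi>_def)
  moreover have "P = (`) \<pi> ` Q"
    unfolding p(1) q(1) map[symmetric] path_edges_conv_pairs pairs_map edges_of_map_prod ..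
  ultimately show ?thesis by blast
qed

text \<open>A permutation carrying Q to P determines the pair (P, Q), because the image of a family without
  any m-cycle contains at most one path of a family in which any two paths create an m-cycle.\<close>

lemma H_cycle_mult_le:
  assumes "m > 0" "I \<subseteq> ham_paths n" "\<And>P Q. P \<in> I \<Longrightarrow> Q \<in> I \<Longrightarrow> \<not> contains_cycle (P \<union> Q) m"
  shows "H_cycle m n * card I \<le> fact n"
proof -
  obtain F where F: "F \<subseteq> ham_paths n"
    "\<And>P Q. P \<in> F \<Longrightarrow> Q \<in> F \<Longrightarrow> P \<noteq> Q \<Longrightarrow> contains_cycle (P \<union> Q) m" "H_cycle m n = card F"
    using H_cycle_attained[of n m] by metis
  have "\<exists>\<pi>. \<pi> permutes {0..<n} \<and> fst PQ = (`) \<pi> ` snd PQ" if "PQ \<in> F \<times> I" for PQ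
    using that F(1) assms(2) by (intro ham_paths_transitive) auto
  then obtain s where s: "\<And>PQ. PQ \<in> F \<times> I \<Longrightarrow> s PQ permutes {0..<n} \<and> fst PQ = (`) (s PQ) ` snd PQ"
    by metis
  have "inj_on s (F \<times> I)"
  proof (rule inj_onI)
    fix PQ PQ' assume a: "PQ \<in> F \<times> I" "PQ' \<in> F \<times> I" "s PQ = s PQ'"
    define \<pi> where "\<pi> = s PQ"
    obtain P Q where PQ: "PQ = (P, Q)" by (cases PQ)
    obtain P' Q' where PQ': "PQ' = (P', Q')" by (cases PQ')
    have inj: "inj \<pi>" using s[OF a(1)] permutes_inj unfolding \<pi>_def by blast
    have img: "P = (`) \<pi> ` Q" "P' = (`) \<pi> ` Q'"
      using s[OF a(1)] s[OF a(2)] a(3) unfolding \<pi>_def PQ PQ' by auto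
    have "P = P'"
    proof (rule ccontr)
      assume "P \<noteq> P'"
      hence "has_cycle (P \<union> P') m"
        using F(2)[of P P'] a unfolding PQ PQ' contains_cycle_conv_has_cycle by auto
      hence "has_cycle ((`) \<pi> ` (Q \<union> Q')) m" unfolding img image_Un .
      hence "has_cycle (Q \<union> Q') m"
        using has_cycle_image[of \<pi> "Q \<union> Q'" m UNIV] inj assms(1) by simp
      thus False using assms(3)[of Q Q'] a unfolding PQ PQ' contains_cycle_conv_has_cycle by auto
    qed
    moreover have "inj ((`) \<pi>)" using inj by (simp add: inj_image_eq_iff inj_on_def)
    hence "Q = Q'" using \<open>P = P'\<close> unfolding img by (simp add: inj_image_eq_iff)
    ultimately show "PQ = PQ'" unfolding PQ PQ' by simp
  qed
  moreover have "s ` (F \<times> I) \<subseteq> {\<pi>. \<pi> permutes {0..<n}}" using s by blast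
  ultimately have "card (F \<times> I) \<le> card {\<pi>. \<pi> permutes {0..<n}}"
    by (rule card_inj_on_le) (simp add: finite_permutations)
  thus ?thesis using F(3) by (simp add: card_cartesian_product card_permutations)
qed

section \<open>Logarithmic estimates\<close>

lemma ln_fact_ge: "real d * ln (real d) - real d \<le> ln (fact d)"
proof (induction d)
  case (Suc d)
  show ?case
  proof (cases "d = 0")
    case False
    \<comment> \<open>The induction step needs d * ln (1 + 1/d) to be at most 1, the growth of the
      linear term.\<close>
    have eq: "real (Suc d) / real d = 1 + 1 / real d" using False by (simp add: field_simps)
    have "ln (real (Suc d) / real d) = ln (real (Suc d)) - ln (real d)"
      using False by (intro ln_divide_pos) auto
    hence "ln (real (Suc d)) - ln (real d) = ln (1 + 1 / real d)" unfolding eq by (rule sym)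
    also have "\<dots> \<le> 1 / real d" by (intro ln_add_one_self_le_self) simp
    finally have "real d * (ln (real (Suc d)) - ln (real d)) \<le> real d * (1 / real d)"
      by (intro mult_left_mono) simp_all
    hence "real d * (ln (real (Suc d)) - ln (real d)) \<le> 1" using False by simp
    moreover have "ln (fact (Suc d) :: real) = ln (real (Suc d)) + ln (fact d)"
      by (simp add: ln_mult)
    moreover have "real (Suc d) * ln (real (Suc d)) = real d * ln (real (Suc d)) + ln (real (Suc d))"
      by (simp add: algebra_simps)
    ultimately show ?thesis using Suc.IH by (simp add: algebra_simps)
  qed simp
qed simp

text \<open>With d * m0 = N, two labellings contribute at least 2 (d ln d - d) per vertex of a layer
  and the voltages cost d ln d, leaving (L - 1) * N * (ln d - 2). The fixed ends cost N ln N. The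
  rest is \<open>H_cycle_mult_le\<close> with n! \<le> n^n.\<close>

lemma ln_H_cycle_le:
  assumes graph: "layered_graph (V :: 'v set) (E :: 'e set) tail head lay L d m"
    and m: "m \<ge> 3" and pos: "L > 0" "d > 0" "N > 0" and N: "d * card {v \<in> V. lay v = 0} = N"
    and n: "N * (L + m) \<le> n" and H: "H_cycle m n > 0"
  shows "ln (H_cycle m n) \<le> real n * ln n - real (L - 1) * N * (ln d - 2) + N * ln N"
proof -
  interpret layered_graph V E tail head lay L d m by (rule graph)
  define m0 where "m0 = card (layer 0)"
  have dm0: "d * m0 = N" using N unfolding m0_def layer_def by simp
  hence m00: "m0 > 0" using pos(3) by (cases m0) auto
  define l where "l = L - 1"
  obtain I where I: "I \<subseteq> ham_paths n" "finite I" "\<forall>P\<in>I. \<forall>Q\<in>I. \<not> contains_cycle (P \<union> Q) m"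
    "fact d ^ (2 * (l * m0)) \<le> d ^ (d * (l * m0)) * N ^ N * card I"
    using cycle_free_ham_paths[OF m pos(1,2) m00[unfolded m0_def], of n] n
    unfolding m0_def[symmetric] dm0 l_def by blast
  have cI: "card I > 0"
  proof (rule ccontr)
    assume "\<not> card I > 0"
    hence "(fact d :: nat) ^ (2 * (l * m0)) \<le> 0" using I(4) by simp
    thus False by simp
  qed
  have "real (fact d ^ (2 * (l * m0))) \<le> real (d ^ (d * (l * m0)) * N ^ N * card I)"
    using I(4) by (simp only: of_nat_le_iff)
  hence "(fact d :: real) ^ (2 * (l * m0)) \<le> real d ^ (d * (l * m0)) * real N ^ N * real (card I)"
    by simp
  hence "ln ((fact d :: real) ^ (2 * (l * m0))) \<le> ln (real d ^ (d * (l * m0)) * real N ^ N * real (card I))"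
    using pos cI by (subst ln_le_cancel_iff) auto
  hence 1: "real (2 * (l * m0)) * ln (fact d) \<le> real (d * (l * m0)) * ln d + N * ln N + ln (card I)"
    using pos cI by (simp add: ln_mult ln_realpow)
  have "real (2 * (l * m0)) * (real d * ln d - d) \<le> real (2 * (l * m0)) * ln (fact d)"
    by (intro mult_left_mono ln_fact_ge) simp
  with 1 have 2: "real l * real (d * m0) * (ln d - 2) - N * ln N \<le> ln (card I)"
    by (simp add: algebra_simps)
  have "H_cycle m n * card I \<le> fact n"
    using m I(1,3) by (intro H_cycle_mult_le) auto
  also have "(fact n :: nat) \<le> n ^ n" using fact_le_power[of n, where 'a = nat] by simp
  finally have "real (H_cycle m n * card I) \<le> real (n ^ n)" by (simp only: of_nat_le_iff)
  hence 3: "real (H_cycle m n) * real (card I) \<le> real n ^ n" by simp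
  have n0: "n > 0" using n pos m by (cases n) auto
  have "ln (real (H_cycle m n) * real (card I)) \<le> ln (real n ^ n)"
    using 3 H cI n0 by (subst ln_le_cancel_iff) auto
  hence "ln (H_cycle m n) + ln (card I) \<le> n * ln n"
    using H cI n0 by (simp add: ln_mult ln_realpow)
  thus ?thesis using 2 unfolding dm0 l_def by linarith
qed

subsection \<open>Asymptotics\<close>

text \<open>The largest admissible j works; maximality gives the upper bound, at the price of a
  constant factor 2^K.\<close>

lemma exists_power_two_between:
  fixes B K n :: nat
  assumes "(2 ^ l) ^ K * B \<le> n" "K > 0" "B > 0"
  obtains j where "l \<le> j" "(2 ^ j) ^ K * B \<le> n" "n < (2 * 2 ^ j) ^ K * B"
proof -
  define S where "S = {j. (2 ^ j) ^ K * B \<le> n}"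
  have "j \<le> n" if "(2 ^ j) ^ K * B \<le> n" for j
  proof -
    have "j < 2 ^ j" by (rule less_exp)
    also have "(2::nat) ^ j \<le> (2 ^ j) ^ K" using assms(2) by (intro self_le_power) auto
    also have "\<dots> \<le> (2 ^ j) ^ K * B" using assms(3) by simp
    finally show ?thesis using that by simp
  qed
  hence "S \<subseteq> {..n}" unfolding S_def by blast
  hence fin: "finite S" by (rule finite_subset) simp
  have l: "l \<in> S" using assms(1) by (simp add: S_def)
  have j: "Max S \<in> S" using fin l by (intro Max_in) auto
  have "Suc (Max S) \<notin> S"
  proof
    assume "Suc (Max S) \<in> S"
    with fin have "Suc (Max S) \<le> Max S" by (rule Max_ge)
    thus False by simp
  qed
  thus ?thesis using that[of "Max S"] j l fin by (auto simp: S_def not_le)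
qed

text \<open>K is the exponent bounding the number of flags, and B contains an extra factor L to make
  rounding errors small. C collects the constants lost between ln n / K and ln d - 2. The condition
  on \<open>2 ^ L\<close> forces q > L, that on C makes ln n / K - C nonnegative.\<close>

lemma ln_H_cycle_bound:
  fixes k L n :: nat and C :: real
  defines "K \<equiv> k + k div 2" and "B \<equiv> (L + 2 * k) * L"
  defines "C \<equiv> ln B / K + ln 2 + ln (2 * real L) + 2"
  assumes k: "k \<ge> 2" and L: "L \<ge> 2" and n: "(2 ^ L) ^ K * B \<le> n" "K * C \<le> ln n"
    and H: "H_cycle (2 * k) n > 0"
  shows "ln (H_cycle (2 * k) n) \<le> (1 - 1 / K + (2 * k + 3) / L) * n * ln n + C * n"
proof -
  define m where "m = 2 * k"
  have K: "K > 0" and B: "B > 0" unfolding K_def B_def using k L by auto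
  obtain j where j: "L \<le> j" "(2 ^ j) ^ K * B \<le> n" "n < (2 * 2 ^ j) ^ K * B"
    using exists_power_two_between[OF n(1) K B] .
  define q :: nat where "q = 2 ^ j"
  define d where "d = q div L"
  have "L < 2 ^ L" by (rule less_exp)
  also have "(2::nat) ^ L \<le> q" unfolding q_def using j(1) by (intro power_increasing) auto
  finally have qL: "L \<le> q" by simp
  have "j > 0" using j(1) L by simp
  from exists_layered_graph[OF this k L qL[unfolded q_def]] obtain w
    where w: "w > 0" "w * d \<le> q ^ K"
      "\<And>c. \<exists>V E tail head lay. layered_graph (V :: (nat \<times> nat \<times> gf2 alg_closure quad) set)
      (E :: (nat \<times> nat \<times> gf2 alg_closure quad) set) tail head lay L d m \<and>
      card {v \<in> V. lay v = 0} = c * w"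
    unfolding d_def q_def K_def m_def by blast
  have d: "d > 0" unfolding d_def using qL L by (simp add: div_greater_zero_iff)
  define N0 where "N0 = w * d"
  \<comment> \<open>As many copies as fit: each copy has N0 lifted vertices per layer, hence N0
    paths, and every path takes L vertices and a connector of m.\<close>
  define c where "c = n div (N0 * (L + m))"
  define N where "N = c * N0"
  have N0: "N0 > 0" unfolding N0_def using w(1) d by simp
  have "N0 * (L + m) * L \<le> q ^ K * B"
    unfolding B_def N0_def m_def using w(2) by (simp add: mult.assoc)
  hence N0_le: "N0 * (L + m) * L \<le> n" using j(2) unfolding q_def by linarith
  have "N0 * (L + m) * 1 \<le> N0 * (L + m) * L" using L by (intro mult_left_mono) auto
  hence "N0 * (L + m) \<le> n" using N0_le by linarith
  hence c: "c > 0" unfolding c_def using N0 L by (simp add: div_greater_zero_iff)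
  have Npos: "N > 0" unfolding N_def using c N0 by simp
  have N_le: "N * (L + m) \<le> n"
  proof -
    have "N * (L + m) = c * (N0 * (L + m))" unfolding N_def by (simp only: mult.assoc)
    also have "\<dots> \<le> n" unfolding c_def by (rule div_times_less_eq_dividend)
    finally show ?thesis .
  qed
  have n0: "n > 0" using N0_le N0 L by (cases n) auto
  obtain V E tail head lay where graph: "layered_graph (V :: (nat \<times> nat \<times> gf2 alg_closure quad) set)
      (E :: (nat \<times> nat \<times> gf2 alg_closure quad) set) tail head lay L d m"
    and "card {v \<in> V. lay v = 0} = c * w" using w(3)[of c] by blast
  hence "d * card {v \<in> V. lay v = 0} = N" unfolding N_def N0_def by simp
  from ln_H_cycle_le[OF graph _ _ d Npos this N_le] have main:
    "ln (H_cycle m n) \<le> n * ln n - real (L - 1) * N * (ln d - 2) + N * ln N"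
    using k L H unfolding m_def by simp
  have ln_n: "ln n \<ge> 0" using n0 by simp
  \<comment> \<open>There are at most n / L paths, so fixing their ends costs a negligible fraction
    1 / L.\<close>
  have Nln: "N * ln N \<le> (n / L) * ln n"
  proof (rule mult_mono)
    have "N * L \<le> N * (L + m)" by simp
    hence "N * L \<le> n" using N_le by linarith
    hence "real N * real L \<le> real n" by (simp flip: of_nat_mult)
    thus "real N \<le> n / L" using L by (simp add: field_simps)
    have "N * 1 \<le> N * L" using L by (intro mult_left_mono) auto
    hence "N \<le> n" using \<open>N * L \<le> n\<close> by linarith
    thus "ln N \<le> ln n" using Npos by simp
  qed (use Npos in auto)
  \<comment> \<open>Combines n < (2 q)^K * B with q \<le> 2 L d, the latter from d = q div
    L.\<close>
  have ln_d: "ln n / K - C \<le> ln d - 2"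
  proof -
    have "q < (d + 1) * L" unfolding d_def using L dividend_less_div_times[of L q] by (simp add: algebra_simps)
    also have "\<dots> \<le> (2 * d) * L" using d by (intro mult_right_mono) auto
    finally have "q \<le> d * (2 * L)" by (simp add: mult_ac)
    hence "real q \<le> real (d * (2 * L))" by (simp only: of_nat_le_iff)
    hence "ln (real q) \<le> ln (real (d * (2 * L)))" using qL L d by (subst ln_le_cancel_iff) auto
    hence 1: "ln q \<le> ln d + ln (2 * real L)" using d L by (simp add: ln_mult)
    have "real n \<le> real ((2 * q) ^ K * B)" using j(3) unfolding q_def by (simp only: of_nat_le_iff)
    hence "ln (real n) \<le> ln (real ((2 * q) ^ K * B))" using n0 qL L B by (subst ln_le_cancel_iff) auto
    hence "ln n \<le> K * (ln 2 + ln q) + ln B" using qL L B by (simp add: ln_mult ln_realpow distrib_left)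
    hence "ln n / K \<le> (K * (ln 2 + ln q) + ln B) / K" by (rule divide_right_mono) simp
    also have "\<dots> = ln 2 + ln q + ln B / K" using K by (simp add: add_divide_distrib)
    finally have "ln n / K \<le> ln 2 + ln q + ln B / K" .
    thus ?thesis using 1 unfolding C_def by linarith
  qed
  have pos: "0 \<le> ln n / K - C" using n(2) K by (simp add: field_simps)
  \<comment> \<open>Rounding n down to a multiple of N0 * (L + m) loses at most n / L, thanks to the
    factor L in B.\<close>
  have N_ge: "(1 - 1 / L) * n / (L + m) \<le> real N"
  proof -
    have "n < (c + 1) * (N0 * (L + m))"
      unfolding c_def using dividend_less_div_times[of "N0 * (L + m)" n] N0 L by (simp add: algebra_simps)
    hence "n < N * (L + m) + N0 * (L + m)" unfolding N_def by (simp add: algebra_simps)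
    hence "real n \<le> real (N * (L + m) + N0 * (L + m))" by (simp only: of_nat_le_iff)
    hence 1: "real n \<le> real N * real (L + m) + real (N0 * (L + m))" by simp
    have "real (N0 * (L + m) * L) \<le> real n" using N0_le by (simp only: of_nat_le_iff)
    hence "real (N0 * (L + m)) \<le> n / L" using L by (simp add: field_simps)
    with 1 have "(1 - 1 / L) * n \<le> real N * real (L + m)" by (simp add: algebra_simps)
    moreover have "real (L + m) > 0" using L by simp
    ultimately show ?thesis by (simp only: pos_divide_le_eq)
  qed
  \<comment> \<open>\<open>\<theta> * n\<close> bounds from below the number (L - 1) * N of edges
    inside the lifted paths; it tends to n as L grows.\<close>
  define \<theta> where "\<theta> = real (L - 1) * (1 - 1 / L) / (L + m)"
  have \<theta>: "1 - (2 * k + 2) / L \<le> \<theta>" "\<theta> \<le> 1"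
  proof -
    have Lr: "real (L - 1) = real L - 1" "real L \<ge> 2" using L by auto
    have eq: "\<theta> = (real L - 1)\<^sup>2 / (real L * (real L + 2 * real k))"
      unfolding \<theta>_def m_def Lr(1) using Lr(2) by (simp add: field_simps power2_eq_square)
    have "(1 - (2 * k + 2) / L) * (real L * (real L + 2 * real k)) \<le> (real L - 1)\<^sup>2"
    proof -
      have "(1 - (2 * k + 2) / L) * (real L * (real L + 2 * real k)) =
          (real L - (2 * k + 2)) * (real L + 2 * real k)"
        using Lr(2) by (simp add: field_simps)
      also have "\<dots> = (real L - 1)\<^sup>2 - 1 - 2 * real k * (2 * real k + 2)"
        by (simp add: algebra_simps power2_eq_square)
      also have "\<dots> \<le> (real L - 1)\<^sup>2"
      proof -
        have "0 \<le> 2 * real k * (2 * real k + 2)" by (intro mult_nonneg_nonneg) auto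
        thus ?thesis by linarith
      qed
      finally show ?thesis .
    qed
    moreover have "real L * (real L + 2 * real k) > 0" using Lr(2) by (intro mult_pos_pos) auto
    ultimately show "1 - (2 * k + 2) / L \<le> \<theta>" unfolding eq by (simp add: pos_le_divide_eq)
    have "(real L - 1)\<^sup>2 \<le> (real L)\<^sup>2" using Lr(2) by (intro power_mono) auto
    also have "\<dots> \<le> real L * (real L + 2 * real k)" by (simp add: power2_eq_square algebra_simps)
    finally show "\<theta> \<le> 1" unfolding eq using \<open>real L * _ > 0\<close> by simp
  qed
  have "\<theta> * n * (ln n / K - C) = real (L - 1) * ((1 - 1 / L) * n / (L + m)) * (ln n / K - C)"
    unfolding \<theta>_def by simp
  also have "\<dots> \<le> real (L - 1) * N * (ln d - 2)"
    using N_ge ln_d pos by (intro mult_mono mult_left_mono) auto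
  finally have "ln (H_cycle m n) \<le> n * ln n - \<theta> * n * (ln n / K - C) + (n / L) * ln n"
    using main Nln by linarith
  also have "\<dots> = n * ln n * (1 - \<theta> / K + 1 / L) + \<theta> * (C * n)"
    by (simp add: field_simps)
  also have "\<dots> \<le> n * ln n * (1 - 1 / K + (2 * k + 3) / L) + 1 * (C * n)"
  proof (rule add_mono[OF mult_left_mono mult_right_mono])
    have "1 / K - \<theta> / K = (1 - \<theta>) / K" by (simp add: diff_divide_distrib)
    also have "\<dots> \<le> (1 - \<theta>) / 1" using \<theta>(2) K by (intro divide_left_mono) auto
    also have "\<dots> \<le> (2 * k + 2) / L" using \<theta>(1) by simp
    finally show "1 - \<theta> / K + 1 / L \<le> 1 - 1 / K + (2 * k + 3) / L"
      by (simp add: add_divide_distrib)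
    show "0 \<le> n * ln n" using ln_n by simp
    show "\<theta> \<le> 1" by (rule \<theta>(2))
    have "ln (real B) \<ge> 0" "ln (2 * real L) \<ge> 0" using B L by auto
    thus "0 \<le> C * n" unfolding C_def by (intro mult_nonneg_nonneg add_nonneg_nonneg divide_nonneg_nonneg) auto
  qed
  finally show ?thesis unfolding m_def by (simp add: mult_ac)
qed

lemma eventually_H_cycle_le:
  fixes k :: nat and \<epsilon> :: real
  assumes k: "k \<ge> 2" and \<epsilon>: "\<epsilon> > 0"
  shows "\<forall>\<^sub>F n in at_top. H_cycle (2 * k) n > 0 \<longrightarrow>
    ln (H_cycle (2 * k) n) \<le> ((1 - 2 / (3 * real k)) + \<epsilon>) * real n * ln n"
proof -
  \<comment> \<open>Chosen so that the layer error (2 k + 3) / L is at most half of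
    \<open>\<epsilon>\<close>; the other half absorbs C * n once ln n \<ge> 2 C /
    \<open>\<epsilon>\<close>.\<close>
  define L where "L = max 2 (nat \<lceil>(2 * k + 3) * 2 / \<epsilon>\<rceil>)"
  define K where "K = k + k div 2"
  define B where "B = (L + 2 * k) * L"
  define C :: real where "C = ln B / K + ln 2 + ln (2 * real L) + 2"
  have L: "L \<ge> 2" unfolding L_def by simp
  have "(2 * k + 3) * 2 / \<epsilon> \<le> L" unfolding L_def by linarith
  hence L_\<epsilon>: "(2 * k + 3) / L \<le> \<epsilon> / 2" using \<epsilon> L by (simp add: field_simps)
  \<comment> \<open>K = k + k div 2 is at most 3 k / 2, which yields the constant of the
    theorem.\<close>
  have K: "2 / (3 * real k) \<le> 1 / K"
  proof -
    have "2 * K \<le> 3 * k"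
      unfolding K_def using div_times_less_eq_dividend[of k 2] by simp
    hence "2 * real K \<le> 3 * real k" by linarith
    moreover have "K > 0" unfolding K_def using k by simp
    ultimately show ?thesis using k by (simp add: field_simps)
  qed
  have lim: "filterlim (\<lambda>n. ln (real n)) at_top at_top"
    by (rule filterlim_compose[OF ln_at_top filterlim_real_sequentially])
  have "\<forall>\<^sub>F n in at_top. K * C \<le> ln (real n)" "\<forall>\<^sub>F n in at_top. 2 * C / \<epsilon> \<le> ln (real n)"
    using lim unfolding filterlim_at_top by blast+
  moreover have "\<forall>\<^sub>F n in at_top. (2 ^ L) ^ K * B \<le> n" by (rule eventually_ge_at_top)
  ultimately show ?thesis
  proof eventually_elim
    case (elim n)
    show ?case
    proof
      assume H: "H_cycle (2 * k) n > 0"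
      have "n \<noteq> 0"
      proof
        assume "n = 0"
        hence "B = 0" using elim(3) by simp
        thus False unfolding B_def using L by simp
      qed
      hence nl: "0 \<le> real n * ln n" by simp
      have "C \<le> (\<epsilon> / 2) * ln n" using elim(2) \<epsilon> by (simp add: field_simps)
      hence "C * n \<le> (\<epsilon> / 2) * ln n * n" by (intro mult_right_mono) auto
      moreover have "ln (H_cycle (2 * k) n) \<le> (1 - 1 / K + (2 * k + 3) / L) * n * ln n + C * n"
        unfolding K_def C_def B_def
        by (rule ln_H_cycle_bound[OF k L _ _ H]) (use elim in \<open>simp_all add: K_def B_def C_def\<close>)
      moreover have "(1 - 1 / K + (2 * k + 3) / L) * (real n * ln n) \<le> (1 - 2 / (3 * real k) + \<epsilon> / 2) * (real n * ln n)"
      proof (rule mult_right_mono[OF _ nl])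
        show "1 - 1 / K + (2 * k + 3) / L \<le> 1 - 2 / (3 * real k) + \<epsilon> / 2"
          using K L_\<epsilon> by linarith
      qed
      ultimately show "ln (H_cycle (2 * k) n) \<le> ((1 - 2 / (3 * real k)) + \<epsilon>) * real n * ln n"
        by (simp add: algebra_simps)
    qed
  qed
qed

theorem theorem3:
  fixes k :: nat
  assumes "k \<ge> 2"
  shows "\<exists>f :: nat \<Rightarrow> real. f \<in> o(\<lambda>n. real n) \<and>
    (\<forall>\<^sub>F n in at_top.
       real (H_cycle (2 * k) n) \<le> real n powr ((1 - 2 / (3 * real k)) * real n + f n))"
proof -
  define \<alpha> where "\<alpha> = 1 - 2 / (3 * real k)"
  \<comment> \<open>The exact excess of the exponent, cut off at 0 so that only an upper bound is
    needed for \<open>f \<in> o(n)\<close>.\<close>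
  define f where "f n = max 0 (log n (H_cycle (2 * k) n) - \<alpha> * n)" for n :: nat
  have \<alpha>: "\<alpha> \<ge> 0" unfolding \<alpha>_def using assms by (simp add: field_simps)
  have "f \<in> o(\<lambda>n. real n)"
  proof (rule landau_o.smallI)
    fix \<epsilon> :: real assume \<epsilon>: "\<epsilon> > 0"
    show "\<forall>\<^sub>F n in at_top. norm (f n) \<le> \<epsilon> * norm (real n)"
      using eventually_H_cycle_le[OF assms \<epsilon>] eventually_ge_at_top[of 2]
    proof eventually_elim
      case (elim n)
      have "log n (H_cycle (2 * k) n) \<le> (\<alpha> + \<epsilon>) * n"
      proof (cases "H_cycle (2 * k) n > 0")
        case True
        thus ?thesis using elim unfolding \<alpha>_def log_def by (simp add: pos_divide_le_eq)
      next
        \<comment> \<open>Here the logarithm takes the default value \<open>ln 0 = 0\<close>, and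
          nonnegativity of the right-hand side suffices.\<close>
        case False
        thus ?thesis using \<alpha> \<epsilon> by (simp add: log_def)
      qed
      hence "f n \<le> \<epsilon> * n" using \<epsilon> unfolding f_def by (simp add: algebra_simps)
      moreover have "f n \<ge> 0" unfolding f_def by simp
      ultimately show ?case by simp
    qed
  qed
  moreover have "\<forall>\<^sub>F n in at_top. real (H_cycle (2 * k) n) \<le> real n powr (\<alpha> * real n + f n)"
    using eventually_ge_at_top[of 2]
  proof eventually_elim
    case (elim n)
    show ?case
    proof (cases "H_cycle (2 * k) n > 0")
      case True
      have "real (H_cycle (2 * k) n) = real n powr (log n (H_cycle (2 * k) n))"
        using True elim by (subst powr_log_cancel) auto
      also have "\<dots> \<le> real n powr (\<alpha> * real n + f n)"
        using elim unfolding f_def by (intro powr_mono) auto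
      finally show ?thesis .
    qed simp
  qed
  ultimately show ?thesis unfolding \<alpha>_def by blast
qed

end
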